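(* Consider the discrete memoryless state-dependent multiaccess channel with degraded message sets described in the context. Let $\mathcal P$ be the set of joint distributions of $(S,U_1,U_2,X_1,X_2,Y)$ of the form $$P_{S,U_1,U_2,X_1,X_2,Y}=Q_S\,P_{U_1}\,P_{X_1|U_1}\,P_{U_2|U_1,S}\,P_{X_2|U_1,U_2,S}\,W_{Y|X_1,X_2,S}$$ which satisfy $I(U_2;Y|U_1,X_1)-I(U_2;S|U_1)>0$, where $U_1\in\mathcal U_1$, $U_2\in\mathcal U_2$ are auxiliary random variables on finite alphabets with $|\mathcal U_1|\le |\mathcal S||\mathcal X_1||\mathcal X_2|+2$ and $|\mathcal U_2|\le (|\mathcal S||\mathcal X_1||\mathcal X_2|+2)|\mathcal S||\mathcal X_1||\mathcal X_2|+2$. Then the capacity region $\mathcal C$ contains the closure of the set of all rate pairs $(R_c,R_1)$ for which there is a distribution in $\mathcal P$ such that $$R_1< I(X_1;Y|U_1,U_2),\qquad R_1< I(X_1,U_2;Y|U_1)-I(U_2;S|U_1),$$ $$R_c+R_1< I(X_1,U_1,U_2;Y)-I(U_2;S|U_1).$$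
   Context: Finite alphabets $\mathcal S,\mathcal X_1,\mathcal X_2,\mathcal Y$. The channel is memoryless with transition law $W_{Y|X_1,X_2,S}$: for length-$n$ sequences, $P(y^n|x_1^n,x_2^n,s^n)=\prod_{i=1}^n W_{Y|X_1,X_2,S}(y_i|x_{1,i},x_{2,i},s_i)$. The state sequence $S^n$ is i.i.d. with law $Q_S$. Two independent messages, uniformly distributed and independent of $S^n$: a common message $W_c\in\{1,\dots,2^{nR_c}\}$ and an individual message $W_1\in\{1,\dots,2^{nR_1}\}$. A $(2^{nR_c},2^{nR_1},n)$-code consists of an encoder $\phi_1^n:\mathcal W_c\times\mathcal W_1\to\mathcal X_1^n$ at the "uninformed" encoder (which does not know the state), an encoder $\phi_2^n:\mathcal S^n\times\mathcal W_c\to\mathcal X_2^n$ at the "informed" encoder (which knows the whole state sequence $S^n$ non-causally and only the common message), and a decoder $\psi^n:\mathcal Y^n\to\mathcal W_c\times\mathcal W_1$; the decoder does not know the state. The error probability is $P_e^n=\Pr[\psi^n(Y^n)\ne(W_c,W_1)]$. A pair $(R_c,R_1)$ is achievable if there is a sequence of such codes with $P_e^n\to0$; the capacity region $\mathcal C$ is the closure of the set of achievable pairs. *)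

theory Defs
  imports "HOL-Probability.Probability"
begin

text \<open>Mutual information and conditional mutual information of random variables
  defined on the probability space of a joint pmf J, exactly as the library
  abbreviations in the locale information_space (with base b = 2).\<close>

definition MI :: "'w pmf \<Rightarrow> ('w \<Rightarrow> 'a) \<Rightarrow> ('w \<Rightarrow> 'b) \<Rightarrow> real" where
  "MI J X Y = prob_space.mutual_information (measure_pmf J) 2
     (count_space (X ` space (measure_pmf J))) (count_space (Y ` space (measure_pmf J))) X Y"

definition CMI :: "'w pmf \<Rightarrow> ('w \<Rightarrow> 'a) \<Rightarrow> ('w \<Rightarrow> 'b) \<Rightarrow> ('w \<Rightarrow> 'c) \<Rightarrow> real" where
  "CMI J X Y Z = prob_space.conditional_mutual_information (measure_pmf J) 2
     (count_space (X ` space (measure_pmf J))) (count_space (Y ` space (measure_pmf J)))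
     (count_space (Z ` space (measure_pmf J))) X Y Z"

text \<open>State law Q :: 's pmf; channel W x1 x2 s :: 'y pmf (the law W(.|x1,x2,s)).
  Length-n sequences are functions on {..<n} (elements of PiE {..<n} (\<lambda>_. UNIV));
  messages are natural numbers, W_c \<in> {..<Mc}, W_1 \<in> {..<M1}.\<close>

definition num_msgs :: "nat \<Rightarrow> real \<Rightarrow> nat" where
  "num_msgs n R = nat \<lceil>2 powr (real n * R)\<rceil>"

text \<open>Average error probability of a code (phi1, phi2, psi) of blocklength n:
  phi1 wc w1 is the codeword of the uninformed encoder, phi2 s wc that of the
  informed encoder (which sees the whole state sequence), psi the decoder.
  Messages are uniform and independent of the i.i.d. state sequence.\<close>

definition err_prob ::
  "'s pmf \<Rightarrow> ('x1 \<Rightarrow> 'x2 \<Rightarrow> 's \<Rightarrow> 'y pmf) \<Rightarrow> nat \<Rightarrow> nat \<Rightarrow> nat \<Rightarrow>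
   (nat \<Rightarrow> nat \<Rightarrow> nat \<Rightarrow> 'x1) \<Rightarrow> ((nat \<Rightarrow> 's) \<Rightarrow> nat \<Rightarrow> nat \<Rightarrow> 'x2) \<Rightarrow>
   ((nat \<Rightarrow> 'y) \<Rightarrow> nat \<times> nat) \<Rightarrow> real" where
  "err_prob Q W n Mc M1 phi1 phi2 psi =
     (1 / (real Mc * real M1)) *
     (\<Sum>wc<Mc. \<Sum>w1<M1.
        \<Sum>s\<in>PiE {..<n} (\<lambda>_. UNIV). \<Sum>y\<in>PiE {..<n} (\<lambda>_. UNIV).
          (\<Prod>i<n. pmf Q (s i)) *
          (\<Prod>i<n. pmf (W (phi1 wc w1 i) (phi2 s wc i) (s i)) (y i)) *
          (if psi y \<noteq> (wc, w1) then 1 else 0))"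

definition achievable ::
  "'s::finite pmf \<Rightarrow> ('x1::finite \<Rightarrow> 'x2::finite \<Rightarrow> 's \<Rightarrow> 'y::finite pmf) \<Rightarrow> real \<Rightarrow> real \<Rightarrow> bool" where
  "achievable Q W Rc R1 \<longleftrightarrow> 0 \<le> Rc \<and> 0 \<le> R1 \<and>
     (\<exists>(phi1 :: nat \<Rightarrow> nat \<Rightarrow> nat \<Rightarrow> nat \<Rightarrow> 'x1) (phi2 :: nat \<Rightarrow> (nat \<Rightarrow> 's) \<Rightarrow> nat \<Rightarrow> nat \<Rightarrow> 'x2)
        (psi :: nat \<Rightarrow> (nat \<Rightarrow> 'y) \<Rightarrow> nat \<times> nat).
        (\<lambda>n. err_prob Q W n (num_msgs n Rc) (num_msgs n R1) (phi1 n) (phi2 n) (psi n))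
          \<longlonglongrightarrow> 0)"

definition capacity_region ::
  "'s::finite pmf \<Rightarrow> ('x1::finite \<Rightarrow> 'x2::finite \<Rightarrow> 's \<Rightarrow> 'y::finite pmf) \<Rightarrow> (real \<times> real) set" where
  "capacity_region Q W = closure {(Rc, R1). achievable Q W Rc R1}"

text \<open>Joint law of (S,U1,U2,X1,X2,Y) = Q_S P_U1 P_X1|U1 P_U2|U1,S P_X2|U1,U2,S W_Y|X1,X2,S.
  Auxiliary alphabets are subsets of the naturals of bounded size.\<close>

definition joint ::
  "'s pmf \<Rightarrow> ('x1 \<Rightarrow> 'x2 \<Rightarrow> 's \<Rightarrow> 'y pmf) \<Rightarrow> nat pmf \<Rightarrow> (nat \<Rightarrow> 'x1 pmf) \<Rightarrow>
   (nat \<Rightarrow> 's \<Rightarrow> nat pmf) \<Rightarrow> (nat \<Rightarrow> nat \<Rightarrow> 's \<Rightarrow> 'x2 pmf) \<Rightarrow>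
   ('s \<times> nat \<times> nat \<times> 'x1 \<times> 'x2 \<times> 'y) pmf" where
  "joint Q W PU1 PX1 PU2 PX2 =
     bind_pmf Q (\<lambda>s. bind_pmf PU1 (\<lambda>u1. bind_pmf (PX1 u1) (\<lambda>x1.
     bind_pmf (PU2 u1 s) (\<lambda>u2. bind_pmf (PX2 u1 u2 s) (\<lambda>x2.
     bind_pmf (W x1 x2 s) (\<lambda>y. return_pmf (s, u1, u2, x1, x2, y)))))))"

definition vS where "vS = (\<lambda>(s, u1, u2, x1, x2, y). s)"
definition vU1 where "vU1 = (\<lambda>(s, u1, u2, x1, x2, y). u1)"
definition vU2 where "vU2 = (\<lambda>(s, u1, u2, x1, x2, y). u2)"
definition vX1 where "vX1 = (\<lambda>(s, u1, u2, x1, x2, y). x1)"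
definition vX2 where "vX2 = (\<lambda>(s, u1, u2, x1, x2, y). x2)"
definition vY where "vY = (\<lambda>(s, u1, u2, x1, x2, y). y)"

definition card_bound_U1 :: "'s::finite itself \<Rightarrow> 'x1::finite itself \<Rightarrow> 'x2::finite itself \<Rightarrow> nat" where
  "card_bound_U1 _ _ _ = CARD('s) * CARD('x1) * CARD('x2) + 2"

definition card_bound_U2 :: "'s::finite itself \<Rightarrow> 'x1::finite itself \<Rightarrow> 'x2::finite itself \<Rightarrow> nat" where
  "card_bound_U2 _ _ _ = (CARD('s) * CARD('x1) * CARD('x2) + 2) * CARD('s) * CARD('x1) * CARD('x2) + 2"

definition admissible ::
  "'s::finite pmf \<Rightarrow> ('x1::finite \<Rightarrow> 'x2::finite \<Rightarrow> 's \<Rightarrow> 'y::finite pmf) \<Rightarrow>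
   ('s \<times> nat \<times> nat \<times> 'x1 \<times> 'x2 \<times> 'y) pmf set" where
  "admissible Q W = {J. \<exists>PU1 PX1 PU2 PX2.
      set_pmf PU1 \<subseteq> {..<card_bound_U1 TYPE('s) TYPE('x1) TYPE('x2)} \<and>
      (\<forall>u1 s. set_pmf (PU2 u1 s) \<subseteq> {..<card_bound_U2 TYPE('s) TYPE('x1) TYPE('x2)}) \<and>
      J = joint Q W PU1 PX1 PU2 PX2 \<and>
      CMI J vU2 vY (\<lambda>w. (vU1 w, vX1 w)) - CMI J vU2 vS vU1 > 0}"

definition rate_set ::
  "'s::finite pmf \<Rightarrow> ('x1::finite \<Rightarrow> 'x2::finite \<Rightarrow> 's \<Rightarrow> 'y::finite pmf) \<Rightarrow> (real \<times> real) set" where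
  "rate_set Q W = {(Rc, R1). 0 \<le> Rc \<and> 0 \<le> R1 \<and> (\<exists>J \<in> admissible Q W.
      R1 < CMI J vX1 vY (\<lambda>w. (vU1 w, vU2 w)) \<and>
      R1 < CMI J (\<lambda>w. (vX1 w, vU2 w)) vY vU1 - CMI J vU2 vS vU1 \<and>
      Rc + R1 < MI J (\<lambda>w. (vX1 w, vU1 w, vU2 w)) vY - CMI J vU2 vS vU1)}"

end

theory Submission
  imports Defs
begin

text \<open>
  Superposition coding combined with Gelfand-Pinsker binning, where both the informed encoder and
  the decoder are replaced by randomised ones that choose an index with probability proportional
  to its likelihood. Given the common message, draw \<open>u\<close>, then independent \<open>x\<^sub>w\<close> and \<open>v\<^sub>j\<close>
  from the conditional laws given \<open>u\<close>; the encoder picks \<open>j\<close> proportionally to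
  \<open>P(v\<^sub>j | u, s) / P(v\<^sub>j | u)\<close>, and the decoder picks a triple of indices proportionally to
  \<open>P(y | u, x, v)\<close>. The probability of success is then the mean of a ratio whose denominator is
  a product \<open>A B\<close> of two sums over the codebook. Since
  \<open>1 / (A B) \<ge> (3 - A / \<alpha> - B / \<beta>) / (\<alpha> \<beta>)\<close>, which is AM-GM for three numbers, it is bounded
  below by the same ratio with \<open>A\<close> and \<open>B\<close> replaced by upper bounds \<open>\<alpha>\<close>, \<open>\<beta>\<close> of their
  conditional means given the transmitted triple. No typical sets and no Markov lemma are needed:
  for product laws every term in \<open>\<alpha>\<close> and \<open>\<beta>\<close> is an exponential of a sum of independent
  information densities, and the weak law of large numbers makes the bound tend to 1 as soon as the
  number of bins has a rate strictly between \<open>I(U\<^sub>2; S | U\<^sub>1)\<close> and the bounds imposed by the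
  decoder. Such a rate exists because \<open>I(U\<^sub>2; Y | U\<^sub>1, X\<^sub>1) > I(U\<^sub>2; S | U\<^sub>1)\<close>.
\<close>

subsection \<open>Expectations under finitely supported mass functions\<close>

abbreviation expect :: "'a pmf \<Rightarrow> ('a \<Rightarrow> real) \<Rightarrow> real"
  where "expect p f \<equiv> measure_pmf.expectation p f"

lemma expect_eq_sum:
  assumes "finite A" "set_pmf p \<subseteq> A"
  shows "expect p f = (\<Sum>x\<in>A. pmf p x * f x)"
  using integral_measure_pmf[OF assms(1), of p f] assms(2) by auto

lemma expect_bind:
  assumes "finite (set_pmf p)" "\<And>x. x \<in> set_pmf p \<Longrightarrow> finite (set_pmf (q x))"
  shows "expect (bind_pmf p q) f = expect p (\<lambda>x. expect (q x) f)"
  using assms by (simp add: pmf_expectation_bind[of "set_pmf p"] expect_eq_sum[of "set_pmf p"])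

lemma expect_cong:
  assumes "\<And>x. x \<in> set_pmf p \<Longrightarrow> f x = g x"
  shows "expect p f = expect p g"
  by (rule integral_cong_AE) (use assms in \<open>auto simp: AE_measure_pmf_iff\<close>)

lemma expect_mono:
  assumes "finite (set_pmf p)" "\<And>x. x \<in> set_pmf p \<Longrightarrow> f x \<le> g x"
  shows "expect p f \<le> expect p g"
  using assms by (simp add: expect_eq_sum[of "set_pmf p"] sum_mono mult_left_mono)

lemma expect_nonneg:
  assumes "\<And>x. x \<in> set_pmf p \<Longrightarrow> 0 \<le> f x"
  shows "0 \<le> expect p f"
  by (rule integral_nonneg_AE) (use assms in \<open>auto simp: AE_measure_pmf_iff\<close>)

lemma expect_le_const:
  assumes "finite (set_pmf p)" "\<And>x. x \<in> set_pmf p \<Longrightarrow> f x \<le> c"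
  shows "expect p f \<le> c"
  using expect_mono[of p f "\<lambda>_. c"] assms by simp

lemma expect_add:
  "finite (set_pmf p) \<Longrightarrow> expect p (\<lambda>x. f x + g x) = expect p f + expect p g"
  by (simp add: Bochner_Integration.integral_add integrable_measure_pmf_finite)

lemma expect_diff:
  "finite (set_pmf p) \<Longrightarrow> expect p (\<lambda>x. f x - g x) = expect p f - expect p g"
  by (simp add: Bochner_Integration.integral_diff integrable_measure_pmf_finite)

lemma expect_sum:
  "finite (set_pmf p) \<Longrightarrow> expect p (\<lambda>x. \<Sum>i\<in>I. f i x) = (\<Sum>i\<in>I. expect p (f i))"
  by (simp add: Bochner_Integration.integral_sum integrable_measure_pmf_finite)

lemma expect_swap:
  assumes "finite (set_pmf p)" "finite (set_pmf q)"
  shows "expect p (\<lambda>x. expect q (f x)) = expect q (\<lambda>y. expect p (\<lambda>x. f x y))"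
  using assms
  by (simp add: expect_eq_sum[of "set_pmf p"] expect_eq_sum[of "set_pmf q"] sum_distrib_left
      mult.left_commute) (rule sum.swap)

lemma expect_delta: "expect p (\<lambda>x. of_bool (x = t) * f x) = pmf p t * f t"
  using integral_measure_pmf[of "{t}" p "\<lambda>x. of_bool (x = t) * f x"] by auto

lemma expect_point: "expect p (\<lambda>x. of_bool (x = t)) = pmf p t"
  using expect_delta[of p t "\<lambda>_. 1"] by simp

lemma pmf_map_expect: "pmf (map_pmf f p) t = expect p (\<lambda>x. of_bool (f x = t))"
  using expect_point[of "map_pmf f p" t] by simp

text \<open>The averaging step of the random coding argument: it picks the codebook and, later, the
  input of the informed encoder.\<close>

lemma exists_ge_expect:
  assumes "finite (set_pmf p)"
  obtains x where "x \<in> set_pmf p" "expect p f \<le> f x"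
proof -
  let ?m = "Max (f ` set_pmf p)"
  have ne: "f ` set_pmf p \<noteq> {}" using set_pmf_not_empty by simp
  obtain x where x: "x \<in> set_pmf p" "?m = f x"
    using Max_in[OF _ ne] assms by auto
  have "expect p f \<le> ?m"
    by (rule expect_le_const) (use assms in auto)
  with x show ?thesis using that by simp
qed

text \<open>Averaging for weights whose total mass may be below 1. Likelihood weights
  \<open>a / sum\<close> all become 0 when the sum is 0, so full mass is not guaranteed;
  nonnegativity of \<open>h\<close> makes up for what is missing.\<close>

lemma exists_ge_subconvex_sum:
  fixes c h :: "'i \<Rightarrow> real"
  assumes "finite I" "I \<noteq> {}" "\<And>i. i \<in> I \<Longrightarrow> 0 \<le> c i" "(\<Sum>i\<in>I. c i) \<le> 1"
    "\<And>i. i \<in> I \<Longrightarrow> 0 \<le> h i"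
  obtains i where "i \<in> I" "(\<Sum>i\<in>I. c i * h i) \<le> h i"
proof -
  let ?m = "Max (h ` I)"
  have "?m \<in> h ` I" using assms(1,2) by (intro Max_in) auto
  then obtain i where i: "i \<in> I" "?m = h i" by auto
  have "(\<Sum>i\<in>I. c i * h i) \<le> (\<Sum>i\<in>I. c i * ?m)"
    using assms by (intro sum_mono mult_left_mono) auto
  also have "\<dots> = (\<Sum>i\<in>I. c i) * ?m" by (simp add: sum_distrib_right)
  also have "\<dots> \<le> 1 * ?m" using assms i by (intro mult_right_mono) auto
  finally show ?thesis using that i by simp
qed

lemma finite_set_Pi_pmf:
  assumes "finite A" "\<And>x. x \<in> A \<Longrightarrow> finite (set_pmf (p x))"
  shows "finite (set_pmf (Pi_pmf A d p))"
  using assms by (auto simp: set_Pi_pmf)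

lemma expect_Pi_component:
  assumes "finite A" "i \<in> A"
  shows "expect (Pi_pmf A d p) (\<lambda>f. F (f i)) = expect (p i) F"
  using integral_map_pmf[of "\<lambda>f. f i" "Pi_pmf A d p" F] Pi_pmf_component[OF assms(1), of i d p] assms(2)
  by simp

text \<open>Component \<open>i\<close> is drawn apart from the rest \<open>B\<close>. Pairwise
  independence is enough for the codebook, where the sent codewords are compared with one competitor
  at a time.\<close>

lemma expect_Pi_two_components:
  assumes A: "finite A" "i \<in> A" "j \<in> A" "i \<noteq> j" and fin: "\<And>x. x \<in> A \<Longrightarrow> finite (set_pmf (p x))"
  shows "expect (Pi_pmf A d p) (\<lambda>f. F (f i) (f j)) = expect (p i) (\<lambda>x. expect (p j) (F x))"
proof -
  define B where "B = A - {i}"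
  have B: "A = insert i B" "finite B" "i \<notin> B" "j \<in> B" using A by (auto simp: B_def)
  have finB: "finite (set_pmf (Pi_pmf B d p))"
    using B fin by (intro finite_set_Pi_pmf) auto
  have "expect (Pi_pmf A d p) (\<lambda>f. F (f i) (f j))
      = expect (p i) (\<lambda>x. expect (Pi_pmf B d p) (\<lambda>f. F x (f j)))"
    unfolding B(1) using B(2-4) A fin finB
    by (subst Pi_pmf_insert') (simp_all add: expect_bind)
  also have "\<dots> = expect (p i) (\<lambda>x. expect (p j) (F x))"
    using B by (simp add: expect_Pi_component[of B j])
  finally show ?thesis .
qed

subsection \<open>Mutual information as expected information density\<close>

lemma distributed_measure_pmf_count_space:
  "distributed (measure_pmf J) (count_space UNIV) X (\<lambda>x. ennreal (pmf (map_pmf X J) x))"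
  unfolding distributed_def
  by (simp add: measure_pmf_eq_density[of "map_pmf X J", symmetric] map_pmf_rep_eq)

text \<open>Countability turns the product of the two counting measures into a counting measure, and
  the density formula into an expectation under the joint mass function.\<close>

lemma mutual_information_pmf:
  fixes X :: "'w \<Rightarrow> 'a::countable" and Y :: "'w \<Rightarrow> 'b::countable"
  shows "prob_space.mutual_information (measure_pmf J) 2 (count_space UNIV) (count_space UNIV) X Y
    = expect J (\<lambda>w. log 2 (pmf (map_pmf (\<lambda>w. (X w, Y w)) J) (X w, Y w)
        / (pmf (map_pmf X J) (X w) * pmf (map_pmf Y J) (Y w))))"
proof -
  have info: "information_space (measure_pmf J) 2" by unfold_locales simp
  have pr: "count_space UNIV \<Otimes>\<^sub>M count_space UNIV = count_space (UNIV :: ('a \<times> 'b) set)"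
    by (simp add: pair_measure_countable)
  let ?p = "map_pmf (\<lambda>w. (X w, Y w)) J"
  let ?l = "\<lambda>t. log 2 (pmf ?p t / (pmf (map_pmf X J) (fst t) * pmf (map_pmf Y J) (snd t)))"
  have "prob_space.mutual_information (measure_pmf J) 2 (count_space UNIV) (count_space UNIV) X Y
     = integral\<^sup>L (count_space UNIV \<Otimes>\<^sub>M count_space UNIV) (\<lambda>t. pmf ?p t * ?l t)"
    by (rule information_space.mutual_information_distr[OF info])
       (auto simp: pr distributed_measure_pmf_count_space
         intro!: sigma_finite_measure_count_space_countable)
  also have "\<dots> = integral\<^sup>L (density (count_space UNIV) (pmf ?p)) ?l"
    unfolding pr by (simp add: integral_density)
  also have "\<dots> = expect ?p ?l" by (simp add: measure_pmf_eq_density)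
  finally show ?thesis by simp
qed

text \<open>\<open>MI\<close> uses counting measure on the image of each variable; surjectivity
  makes it the counting measure of the whole type.\<close>

lemma MI_eq_expect:
  fixes X :: "'w \<Rightarrow> 'a::countable" and Y :: "'w \<Rightarrow> 'b::countable"
  assumes "range X = UNIV" "range Y = UNIV"
  shows "MI J X Y = expect J (\<lambda>w. log 2 (pmf (map_pmf (\<lambda>w. (X w, Y w)) J) (X w, Y w)
        / (pmf (map_pmf X J) (X w) * pmf (map_pmf Y J) (Y w))))"
  using assms by (simp add: MI_def mutual_information_pmf)

lemma pmf_map_pos: "w \<in> set_pmf J \<Longrightarrow> 0 < pmf (map_pmf f J) (f w)"
  by (simp add: pmf_positive)

text \<open>Conditional information is by definition \<open>I(X; (Y, Z)) - I(X; Z)\<close>. The two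
  logarithms are subtracted pointwise on the support, where all masses are positive and the factor
  of \<open>X\<close> cancels.\<close>

lemma CMI_eq_expect:
  fixes X :: "'w \<Rightarrow> 'a::countable" and Y :: "'w \<Rightarrow> 'b::countable" and Z :: "'w \<Rightarrow> 'c::countable"
  assumes fin: "finite (set_pmf J)" and "range X = UNIV" "range Y = UNIV" "range Z = UNIV"
  shows "CMI J X Y Z = expect J (\<lambda>w. log 2
      (pmf (map_pmf (\<lambda>w. (X w, Y w, Z w)) J) (X w, Y w, Z w) * pmf (map_pmf Z J) (Z w)
        / (pmf (map_pmf (\<lambda>w. (X w, Z w)) J) (X w, Z w) * pmf (map_pmf (\<lambda>w. (Y w, Z w)) J) (Y w, Z w))))"
proof -
  have pr: "count_space UNIV \<Otimes>\<^sub>M count_space UNIV = count_space (UNIV :: ('b \<times> 'c) set)"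
    by (simp add: pair_measure_countable)
  show ?thesis
    unfolding CMI_def prob_space.conditional_mutual_information_def[OF measure_pmf.prob_space_axioms]
    using assms
    apply (simp add: pr mutual_information_pmf expect_diff[symmetric])
    apply (intro expect_cong)
    subgoal for w
      using pmf_map_pos[of w J X] pmf_map_pos[of w J Z] pmf_map_pos[of w J "\<lambda>w. (X w, Y w, Z w)"]
        pmf_map_pos[of w J "\<lambda>w. (X w, Z w)"] pmf_map_pos[of w J "\<lambda>w. (Y w, Z w)"]
      by (simp add: log_divide log_mult)
    done
qed

subsection \<open>A weak law of large numbers\<close>

text \<open>A function is bounded on a finite support, so Hoeffding's inequality applies and gives
  the geometric bound \<open>2 * r ^ n\<close>.\<close>

lemma weak_law_Pi_pmf:
  fixes f :: "'w \<Rightarrow> real"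
  assumes fin: "finite (set_pmf J)" and \<delta>: "\<delta> > 0"
  shows "(\<lambda>n. measure_pmf.prob (Pi_pmf {..<n} d (\<lambda>_. J))
      {\<omega>. real n * \<delta> \<le> \<bar>(\<Sum>i<n. f (\<omega> i)) - real n * expect J f\<bar>}) \<longlonglongrightarrow> 0"
proof -
  \<comment> \<open>Adding 1 keeps \<open>b\<close> positive even when \<open>f\<close> vanishes on
    the support, as the division by \<open>b\<^sup>2\<close> requires.\<close>
  define b where "b = Max ((\<lambda>w. \<bar>f w\<bar>) ` set_pmf J) + 1"
  have fb: "\<bar>f w\<bar> \<le> b - 1" if "w \<in> set_pmf J" for w
    unfolding b_def using Max_ge[of "(\<lambda>w. \<bar>f w\<bar>) ` set_pmf J" "\<bar>f w\<bar>"] that fin by auto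
  obtain w0 where "w0 \<in> set_pmf J" using set_pmf_not_empty by fast
  with fb[of w0] have b: "b > 0" by linarith
  have bd: "measure_pmf.prob (Pi_pmf {..<n} d (\<lambda>_. J))
      {\<omega>. real n * \<delta> \<le> \<bar>(\<Sum>i<n. f (\<omega> i)) - real n * expect J f\<bar>}
      \<le> 2 * exp (- (\<delta>\<^sup>2 / (2 * b\<^sup>2)) * real n)" if "n > 0" for n
  proof -
    let ?P = "Pi_pmf {..<n} d (\<lambda>_. J)"
    have mu: "expect ?P (\<lambda>\<omega>. f (\<omega> i)) = expect J f" if "i < n" for i
      using that by (simp add: expect_Pi_component)
    interpret H: Hoeffding_ineq "measure_pmf ?P" "{..<n}" "\<lambda>i \<omega>. f (\<omega> i)" "\<lambda>_. - b" "\<lambda>_. b"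
      "\<Sum>i<n. expect ?P (\<lambda>\<omega>. f (\<omega> i))"
    proof unfold_locales
      show "prob_space.indep_vars (measure_pmf ?P) (\<lambda>_. borel) (\<lambda>i \<omega>. f (\<omega> i)) {..<n}"
        using prob_space.indep_vars_compose2[OF measure_pmf.prob_space_axioms
            indep_vars_Pi_pmf[of "{..<n}" d "\<lambda>_. J"], of "\<lambda>_. f" "\<lambda>_. borel"] by simp
      fix i assume i: "i \<in> {..<n}"
      have "\<omega> i \<in> set_pmf J" if "\<omega> \<in> set_pmf ?P" for \<omega>
        using that i by (auto simp: set_Pi_pmf PiE_dflt_def)
      then have "f (\<omega> i) \<in> {- b..b}" if "\<omega> \<in> set_pmf ?P" for \<omega>
        using fb[of "\<omega> i"] that by (auto simp: abs_le_iff)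
      then show "AE \<omega> in measure_pmf ?P. f (\<omega> i) \<in> {- b..b}"
        by (simp add: AE_measure_pmf_iff)
    qed simp_all
    have "measure_pmf.prob ?P {\<omega>. real n * \<delta> \<le> \<bar>(\<Sum>i<n. f (\<omega> i)) - real n * expect J f\<bar>}
        \<le> 2 * exp (- 2 * (real n * \<delta>)\<^sup>2 / (\<Sum>i<n. (b - - b)\<^sup>2))"
      using H.Hoeffding_ineq_abs_ge[of "real n * \<delta>"] \<delta> b that by (simp add: mu)
    also have "- 2 * (real n * \<delta>)\<^sup>2 / (\<Sum>i<n. (b - - b)\<^sup>2) = - (\<delta>\<^sup>2 / (2 * b\<^sup>2)) * real n"
      using that b by (simp add: field_simps power2_eq_square)
    finally show ?thesis .
  qed
  have c: "\<delta>\<^sup>2 / (2 * b\<^sup>2) > 0" using \<delta> b by simp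
  define r where "r = exp (- (\<delta>\<^sup>2 / (2 * b\<^sup>2)))"
  have r: "0 \<le> r" "r < 1" using c by (simp_all add: r_def)
  have bd': "measure_pmf.prob (Pi_pmf {..<n} d (\<lambda>_. J))
      {\<omega>. real n * \<delta> \<le> \<bar>(\<Sum>i<n. f (\<omega> i)) - real n * expect J f\<bar>} \<le> 2 * r ^ n" if "n > 0" for n
    using bd[OF that] by (simp only: r_def exp_of_nat2_mult[symmetric])
  have lim: "(\<lambda>n. 2 * r ^ n) \<longlonglongrightarrow> 0"
    using tendsto_mult_right_zero[OF LIMSEQ_power_zero[of r]] r by simp
  show ?thesis
  proof (rule tendsto_sandwich[OF _ _ tendsto_const lim])
    show "\<forall>\<^sub>F n in sequentially. measure_pmf.prob (Pi_pmf {..<n} d (\<lambda>_. J))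
      {\<omega>. real n * \<delta> \<le> \<bar>(\<Sum>i<n. f (\<omega> i)) - real n * expect J f\<bar>} \<le> 2 * r ^ n"
      using eventually_gt_at_top[of 0] by (rule eventually_mono) (rule bd')
  qed simp
qed

subsection \<open>A one-shot random coding bound\<close>

text \<open>The left side is the tangent plane at \<open>p = q = 1\<close> of the convex function
  \<open>1 / (p * q)\<close>. Replacing \<open>p\<close> and \<open>q\<close> by their mean
  \<open>m\<close> can only raise the product, which leaves
  \<open>m\<^sup>2 * (3 - 2 * m) \<le> 1\<close>.\<close>

lemma inverse_mult_ge_tangent:
  fixes p q :: real
  assumes "p > 0" "q > 0"
  shows "3 - p - q \<le> 1 / (p * q)"
proof (cases "3 - p - q \<le> 0")
  case True
  then show ?thesis using assms by (smt (verit) divide_nonneg_pos mult_pos_pos)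
next
  case False
  define m where "m = (p + q) / 2"
  have m: "m > 0" "3 - p - q = 3 - 2 * m" using assms by (auto simp: m_def field_simps)
  have "m\<^sup>2 - p * q = ((p - q) / 2)\<^sup>2" by (simp add: m_def power2_eq_square field_simps)
  then have "p * q \<le> m\<^sup>2" using zero_le_power2[of "(p - q) / 2"] by linarith
  then have "p * q * (3 - 2 * m) \<le> m\<^sup>2 * (3 - 2 * m)"
    using False m by (intro mult_right_mono) auto
  also have "\<dots> = 1 - (1 - m)\<^sup>2 * (1 + 2 * m)" by (simp add: power2_eq_square algebra_simps)
  also have "\<dots> \<le> 1" using m by simp
  finally show ?thesis using assms unfolding m(2) by (simp add: pos_le_divide_eq mult.commute)
qed

lemma sum_of_bool_mult: "j < n \<Longrightarrow> (\<Sum>i<n. of_bool (i = j) * f i) = (f j :: real)"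
  for j :: nat
  by (simp add: of_bool_def if_distrib[of "\<lambda>x. x * _"] cong: if_cong)

text \<open>Each letter stands here for a whole sequence. \<open>PB u\<close> generates the
  codewords of the informed encoder without knowledge of the state, \<open>J\<close> is their number
  per common message, and \<open>g\<close> is the decoding metric. \<open>Zs\<close> and
  \<open>Ys\<close> are explicit finite carriers because the types of sequences need not be
  finite.\<close>

locale one_shot =
  fixes Q :: "'s pmf" and PU :: "'u pmf" and PX :: "'u \<Rightarrow> 'x pmf" and PV :: "'u \<Rightarrow> 's \<Rightarrow> 'v pmf"
    and PB :: "'u \<Rightarrow> 'v pmf" and PZ :: "'u \<Rightarrow> 'v \<Rightarrow> 's \<Rightarrow> 'z pmf" and W :: "'x \<Rightarrow> 'z \<Rightarrow> 's \<Rightarrow> 'y pmf"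
    and g :: "'u \<Rightarrow> 'x \<Rightarrow> 'v \<Rightarrow> 'y \<Rightarrow> real" and Mc M1 J :: nat
    and Zs :: "'z set" and Ys :: "'y set"
  assumes fin_Q: "finite (set_pmf Q)" and fin_PU: "finite (set_pmf PU)"
    and fin_PX: "\<And>u. finite (set_pmf (PX u))" and fin_PB: "\<And>u. finite (set_pmf (PB u))"
    and Zs: "finite Zs" "\<And>u v s. set_pmf (PZ u v s) \<subseteq> Zs"
    and Ys: "finite Ys" "\<And>x z s. set_pmf (W x z s) \<subseteq> Ys"
    and PV_PB: "\<And>u s. s \<in> set_pmf Q \<Longrightarrow> set_pmf (PV u s) \<subseteq> set_pmf (PB u)"
    and g_nonneg: "\<And>u x v y. 0 \<le> g u x v y"
    and sizes: "0 < Mc" "0 < M1" "0 < J"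
begin

text \<open>The density of \<open>PV u s\<close> with respect to \<open>PB u\<close>: weighting
  blindly drawn codewords by it imitates a draw that depends on the state.\<close>

definition lr :: "'u \<Rightarrow> 'v \<Rightarrow> 's \<Rightarrow> real" where
  "lr u v s = pmf (PV u s) v / pmf (PB u) v"

text \<open>The codewords of one common message: a cloud centre, \<open>M1\<close> satellites for
  the individual messages and \<open>J\<close> satellites for the informed encoder, the two families
  independent given the centre.\<close>

definition cluster :: "('u \<times> (nat \<Rightarrow> 'x) \<times> (nat \<Rightarrow> 'v)) pmf" where
  "cluster = bind_pmf PU (\<lambda>u. bind_pmf (Pi_pmf {..<M1} undefined (\<lambda>_. PX u)) (\<lambda>xs.
     bind_pmf (Pi_pmf {..<J} undefined (\<lambda>_. PB u)) (\<lambda>vs. return_pmf (u, xs, vs))))"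

definition codebook :: "(nat \<Rightarrow> 'u \<times> (nat \<Rightarrow> 'x) \<times> (nat \<Rightarrow> 'v)) pmf" where
  "codebook = Pi_pmf {..<Mc} undefined (\<lambda>_. cluster)"

abbreviation cU where "cU c \<equiv> fst c"
abbreviation cX where "cX c w \<equiv> fst (snd c) w"
abbreviation cV where "cV c j \<equiv> snd (snd c) j"

definition triple :: "('u \<Rightarrow> 'x \<Rightarrow> 'v \<Rightarrow> real) \<Rightarrow> real" where
  "triple F = expect PU (\<lambda>u. expect (PX u) (\<lambda>x. expect (PB u) (\<lambda>v. F u x v)))"

text \<open>An upper bound on the expected total score of all codeword triples, given the triple
  \<open>(u, x, v)\<close> of the transmitted message.\<close>

definition total :: "('u \<Rightarrow> 'x \<Rightarrow> 'v \<Rightarrow> real) \<Rightarrow> 'u \<Rightarrow> 'x \<Rightarrow> 'v \<Rightarrow> real" where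
  "total h u x v = h u x v + M1 * expect (PX u) (\<lambda>x'. h u x' v) + J * expect (PB u) (\<lambda>v'. h u x v')
     + M1 * J * expect (PX u) (\<lambda>x'. expect (PB u) (\<lambda>v'. h u x' v')) + Mc * M1 * J * triple h"

section \<open>Moments of the random codebook\<close>

lemma fin_cluster: "finite (set_pmf cluster)"
  unfolding cluster_def using fin_PU fin_PX fin_PB by (auto intro!: finite_set_Pi_pmf)

lemma fin_codebook: "finite (set_pmf codebook)"
  unfolding codebook_def using fin_cluster by (auto intro!: finite_set_Pi_pmf)

lemma expect_cluster:
  "expect cluster F = expect PU (\<lambda>u. expect (Pi_pmf {..<M1} undefined (\<lambda>_. PX u))
     (\<lambda>xs. expect (Pi_pmf {..<J} undefined (\<lambda>_. PB u)) (\<lambda>vs. F (u, xs, vs))))"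
  unfolding cluster_def using fin_PU fin_PX fin_PB
  by (simp add: expect_bind finite_set_Pi_pmf)

lemma expect_cluster_triple:
  assumes "w < M1" "j < J"
  shows "expect cluster (\<lambda>c. F (cU c) (cX c w) (cV c j)) = triple F"
  unfolding expect_cluster triple_def using assms
  by (simp add: expect_Pi_component[where F = "\<lambda>v. F _ _ v"]
      expect_Pi_component[where F = "\<lambda>x. expect (PB _) (F _ x)"])

lemma expect_codebook_component:
  "k < Mc \<Longrightarrow> expect codebook (\<lambda>c. F (c k)) = expect cluster F"
  unfolding codebook_def by (simp add: expect_Pi_component)

lemma expect_codebook_two_components:
  "k < Mc \<Longrightarrow> l < Mc \<Longrightarrow> k \<noteq> l \<Longrightarrow>
    expect codebook (\<lambda>c. F (c k) (c l)) = expect cluster (\<lambda>c. expect cluster (F c))"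
  unfolding codebook_def by (simp add: expect_Pi_two_components fin_cluster)

text \<open>Clusters are independent, so a competitor under another common message contributes the
  constant \<open>triple h\<close>.\<close>

lemma expect_other_cluster:
  assumes "k < Mc" "k' < Mc" "k \<noteq> k'" "w < M1" "w' < M1" "j < J" "j' < J"
  shows "expect codebook (\<lambda>c. F (cU (c k)) (cX (c k) w) (cV (c k) j)
      * h (cU (c k')) (cX (c k') w') (cV (c k') j')) = triple (\<lambda>u x v. F u x v * triple h)"
  using expect_codebook_two_components[OF assms(1-3),
      of "\<lambda>a b. F (cU a) (cX a w) (cV a j) * h (cU b) (cX b w') (cV b j')"]
    expect_cluster_triple[OF assms(5,7), of h]
    expect_cluster_triple[OF assms(4,6), of "\<lambda>u x v. F u x v * triple h"]
  by simp

text \<open>Inside a cluster the centre is shared, and the competitor is redrawn in exactly the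
  coordinates where its index differs from the sent one. The four cases are the first four terms of
  \<open>total\<close>, without their multiplicities.\<close>

lemma expect_same_cluster:
  assumes "k < Mc" "w < M1" "w' < M1" "j < J" "j' < J"
  shows "expect codebook (\<lambda>c. F (cU (c k)) (cX (c k) w) (cV (c k) j)
      * h (cU (c k)) (cX (c k) w') (cV (c k) j')) = triple (\<lambda>u x v. F u x v *
        (if w' = w then if j' = j then h u x v else expect (PB u) (\<lambda>v'. h u x v')
         else if j' = j then expect (PX u) (\<lambda>x'. h u x' v)
         else expect (PX u) (\<lambda>x'. expect (PB u) (\<lambda>v'. h u x' v'))))"
    (is "_ = triple ?R")
proof -
  have V: "expect (Pi_pmf {..<J} undefined (\<lambda>_. PB u)) (\<lambda>vs. F u x (vs j) * h u x' (vs j'))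
    = expect (PB u) (\<lambda>v. F u x v * (if j' = j then h u x' v else expect (PB u) (\<lambda>v'. h u x' v')))"
    for u x x'
    using assms expect_Pi_component[of "{..<J}" j undefined "\<lambda>_. PB u" "\<lambda>v. F u x v * h u x' v"]
      expect_Pi_two_components[of "{..<J}" j j' "\<lambda>_. PB u" undefined "\<lambda>v v'. F u x v * h u x' v'"]
    by (cases "j' = j") (auto simp: fin_PB)
  have X: "expect (Pi_pmf {..<M1} undefined (\<lambda>_. PX u)) (\<lambda>xs. K (xs w) (xs w'))
    = (if w' = w then expect (PX u) (\<lambda>x. K x x) else expect (PX u) (\<lambda>x. expect (PX u) (K x)))"
    for u and K :: "'x \<Rightarrow> 'x \<Rightarrow> real"
    using assms expect_Pi_component[of "{..<M1}" w undefined "\<lambda>_. PX u" "\<lambda>x. K x x"]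
      expect_Pi_two_components[of "{..<M1}" w w' "\<lambda>_. PX u" undefined K]
    by (cases "w' = w") (auto simp: fin_PX)
  have "expect codebook (\<lambda>c. F (cU (c k)) (cX (c k) w) (cV (c k) j)
      * h (cU (c k)) (cX (c k) w') (cV (c k) j'))
      = expect PU (\<lambda>u. expect (Pi_pmf {..<M1} undefined (\<lambda>_. PX u))
         (\<lambda>xs. expect (PB u) (\<lambda>v. F u (xs w) v * (if j' = j then h u (xs w') v
              else expect (PB u) (\<lambda>v'. h u (xs w') v')))))"
    using expect_codebook_component[OF assms(1), of "\<lambda>c. F (cU c) (cX c w) (cV c j) * h (cU c) (cX c w') (cV c j')"]
    by (simp add: expect_cluster V)
  moreover have "expect (Pi_pmf {..<M1} undefined (\<lambda>_. PX u))
         (\<lambda>xs. expect (PB u) (\<lambda>v. F u (xs w) v * (if j' = j then h u (xs w') v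
              else expect (PB u) (\<lambda>v'. h u (xs w') v')))) = expect (PX u) (\<lambda>x. expect (PB u) (?R u x))" for u
  proof (cases "w' = w")
    case True
    then show ?thesis
      using X[where K = "\<lambda>x x'. expect (PB u) (\<lambda>v. F u x v * (if j' = j then h u x' v
              else expect (PB u) (\<lambda>v'. h u x' v')))"] by simp
  next
    case False
    have "expect (PX u) (\<lambda>x'. expect (PB u) (\<lambda>v. F u x v * (if j' = j then h u x' v
              else expect (PB u) (\<lambda>v'. h u x' v')))) = expect (PB u) (?R u x)" for x
      using False by (subst expect_swap[OF fin_PX fin_PB]) (cases "j' = j"; simp)
    then show ?thesis
      using False X[where K = "\<lambda>x x'. expect (PB u) (\<lambda>v. F u x v * (if j' = j then h u x' v
              else expect (PB u) (\<lambda>v'. h u x' v')))"] by simp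
  qed
  ultimately show ?thesis unfolding triple_def by simp
qed

lemma triple_mono:
  assumes "\<And>u x v. F u x v \<le> G u x v"
  shows "triple F \<le> triple G"
  unfolding triple_def using assms by (intro expect_mono fin_PU fin_PX fin_PB)

lemma triple_nonneg: "(\<And>u x v. 0 \<le> F u x v) \<Longrightarrow> 0 \<le> triple F"
  unfolding triple_def by (intro expect_nonneg)

lemma triple_sum: "triple (\<lambda>u x v. \<Sum>i\<in>I. F i u x v) = (\<Sum>i\<in>I. triple (F i))"
  unfolding triple_def by (simp add: expect_sum fin_PU fin_PX fin_PB)

lemma expect_total_score:
  assumes kwj: "k < Mc" "w < M1" "j < J"
    and F: "\<And>u x v. 0 \<le> F u x v" and h: "\<And>u x v. 0 \<le> h u x v"
  shows "expect codebook (\<lambda>c. F (cU (c k)) (cX (c k) w) (cV (c k) j)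
      * (\<Sum>k'<Mc. \<Sum>w'<M1. \<Sum>j'<J. h (cU (c k')) (cX (c k') w') (cV (c k') j')))
      \<le> triple (\<lambda>u x v. F u x v * total h u x v)"
proof -
  let ?a = "\<lambda>u x v. h u x v" and ?b = "\<lambda>u x v. expect (PX u) (\<lambda>x'. h u x' v)"
    and ?c = "\<lambda>u x v. expect (PB u) (\<lambda>v'. h u x v')"
    and ?d = "\<lambda>u x v. expect (PX u) (\<lambda>x'. expect (PB u) (\<lambda>v'. h u x' v'))"
  \<comment> \<open>\<open>\<gamma>\<close> bounds the conditional mean of one competitor. Its
    indicators may switch on several terms at once; this overcount makes the sum over all indices
    equal to \<open>total\<close>.\<close>
  define \<gamma> where "\<gamma> k' w' j' u x v = of_bool (k' = k) * (of_bool (w' = w) * (of_bool (j' = j) * ?a u x v)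
     + of_bool (j' = j) * ?b u x v + of_bool (w' = w) * ?c u x v + ?d u x v) + triple h"
    for k' w' j' u x v
  have nn: "0 \<le> ?a u x v" "0 \<le> ?b u x v" "0 \<le> ?c u x v" "0 \<le> ?d u x v" "0 \<le> triple h" for u x v
    using h by (auto intro!: expect_nonneg triple_nonneg)
  have each: "expect codebook (\<lambda>c. F (cU (c k)) (cX (c k) w) (cV (c k) j)
      * h (cU (c k')) (cX (c k') w') (cV (c k') j')) \<le> triple (\<lambda>u x v. F u x v * \<gamma> k' w' j' u x v)"
    if "k' < Mc" "w' < M1" "j' < J" for k' w' j'
  proof (cases "k' = k")
    case False
    with that kwj have "expect codebook (\<lambda>c. F (cU (c k)) (cX (c k) w) (cV (c k) j)
      * h (cU (c k')) (cX (c k') w') (cV (c k') j')) = triple (\<lambda>u x v. F u x v * triple h)"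
      by (intro expect_other_cluster) auto
    also have "\<dots> \<le> triple (\<lambda>u x v. F u x v * \<gamma> k' w' j' u x v)"
      using F False by (intro triple_mono mult_left_mono) (auto simp: \<gamma>_def)
    finally show ?thesis .
  next
    case True
    show ?thesis unfolding True
      by (subst expect_same_cluster) (use F nn that kwj in \<open>auto intro!: triple_mono mult_left_mono simp: \<gamma>_def\<close>)
  qed
  have "expect codebook (\<lambda>c. F (cU (c k)) (cX (c k) w) (cV (c k) j)
      * (\<Sum>k'<Mc. \<Sum>w'<M1. \<Sum>j'<J. h (cU (c k')) (cX (c k') w') (cV (c k') j')))
    = (\<Sum>k'<Mc. \<Sum>w'<M1. \<Sum>j'<J. expect codebook (\<lambda>c. F (cU (c k)) (cX (c k) w) (cV (c k) j)
      * h (cU (c k')) (cX (c k') w') (cV (c k') j')))"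
    by (simp add: sum_distrib_left expect_sum fin_codebook)
  also have "\<dots> \<le> (\<Sum>k'<Mc. \<Sum>w'<M1. \<Sum>j'<J. triple (\<lambda>u x v. F u x v * \<gamma> k' w' j' u x v))"
    by (intro sum_mono each) auto
  also have "\<dots> = triple (\<lambda>u x v. F u x v * (\<Sum>k'<Mc. \<Sum>w'<M1. \<Sum>j'<J. \<gamma> k' w' j' u x v))"
    by (simp add: triple_sum[symmetric] sum_distrib_left)
  also have "(\<lambda>u x v. F u x v * (\<Sum>k'<Mc. \<Sum>w'<M1. \<Sum>j'<J. \<gamma> k' w' j' u x v))
      = (\<lambda>u x v. F u x v * total h u x v)"
    using kwj by (simp add: \<gamma>_def total_def sum.distrib sum_distrib_left[symmetric]
        sum_of_bool_mult distrib_left mult.assoc)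
  finally show ?thesis .
qed

section \<open>The normaliser of the likelihood encoder\<close>

lemma lr_nonneg: "0 \<le> lr u v s"
  by (simp add: lr_def)

text \<open>Only an inequality, because for \<open>s\<close> outside the support of \<open>Q\<close>
  the law \<open>PV u s\<close> may charge points that \<open>PB u\<close> misses.\<close>

lemma expect_lr_le_1: "expect (PB u) (\<lambda>v. lr u v s) \<le> 1"
proof -
  have "expect (PB u) (\<lambda>v. lr u v s) = (\<Sum>v\<in>set_pmf (PB u). pmf (PV u s) v)"
    using fin_PB by (simp add: expect_eq_sum[of "set_pmf (PB u)"] lr_def pmf_eq_0_set_pmf)
  also have "\<dots> \<le> 1"
    using fin_PB by (simp add: measure_measure_pmf_finite[symmetric])
  finally show ?thesis .
qed

text \<open>Given the sent triple, the ratio at \<open>j\<close> itself is kept, and every index is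
  charged the mean bound 1, which gives \<open>lr u v s + J\<close>.\<close>

lemma expect_total_lr:
  assumes kwj: "k < Mc" "w < M1" "j < J" and F: "\<And>u x v. 0 \<le> F u x v"
  shows "expect codebook (\<lambda>c. F (cU (c k)) (cX (c k) w) (cV (c k) j)
      * (\<Sum>j'<J. lr (cU (c k)) (cV (c k) j') s)) \<le> triple (\<lambda>u x v. F u x v * (lr u v s + J))"
proof -
  have each: "expect codebook (\<lambda>c. F (cU (c k)) (cX (c k) w) (cV (c k) j)
      * lr (cU (c k)) (cV (c k) j') s)
      \<le> triple (\<lambda>u x v. F u x v * (of_bool (j' = j) * lr u v s + 1))" if "j' < J" for j'
    by (subst expect_same_cluster[OF kwj(1,2,2,3) that, of F "\<lambda>u x v. lr u v s"])
       (use F in \<open>auto intro!: triple_mono mult_left_mono mult_left_le simp: expect_lr_le_1\<close>)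
  have "expect codebook (\<lambda>c. F (cU (c k)) (cX (c k) w) (cV (c k) j)
      * (\<Sum>j'<J. lr (cU (c k)) (cV (c k) j') s))
    = (\<Sum>j'<J. expect codebook (\<lambda>c. F (cU (c k)) (cX (c k) w) (cV (c k) j)
      * lr (cU (c k)) (cV (c k) j') s))"
    by (simp add: sum_distrib_left expect_sum fin_codebook)
  also have "\<dots> \<le> (\<Sum>j'<J. triple (\<lambda>u x v. F u x v * (of_bool (j' = j) * lr u v s + 1)))"
    by (intro sum_mono each) auto
  also have "\<dots> = triple (\<lambda>u x v. F u x v * (\<Sum>j'<J. of_bool (j' = j) * lr u v s + 1))"
    by (simp add: triple_sum[symmetric] sum_distrib_left)
  also have "\<dots> = triple (\<lambda>u x v. F u x v * (lr u v s + J))"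
    using kwj by (simp add: sum.distrib sum_of_bool_mult)
  finally show ?thesis .
qed

section \<open>Likelihood encoding and decoding with a random codebook\<close>

abbreviation score :: "(nat \<Rightarrow> 'u \<times> (nat \<Rightarrow> 'x) \<times> (nat \<Rightarrow> 'v)) \<Rightarrow> nat \<Rightarrow> nat \<Rightarrow> nat \<Rightarrow> 'y \<Rightarrow> real" where
  "score c k w j y \<equiv> g (cU (c k)) (cX (c k) w) (cV (c k) j) y"

definition sum_lr :: "(nat \<Rightarrow> 'u \<times> (nat \<Rightarrow> 'x) \<times> (nat \<Rightarrow> 'v)) \<Rightarrow> nat \<Rightarrow> 's \<Rightarrow> real" where
  "sum_lr c k s = (\<Sum>j<J. lr (cU (c k)) (cV (c k) j) s)"

definition sum_score :: "(nat \<Rightarrow> 'u \<times> (nat \<Rightarrow> 'x) \<times> (nat \<Rightarrow> 'v)) \<Rightarrow> 'y \<Rightarrow> real" where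
  "sum_score c y = (\<Sum>k<Mc. \<Sum>w<M1. \<Sum>j<J. score c k w j y)"

text \<open>The \<beta> of the tangent bound: it dominates the mean of \<open>sum_score\<close>
  given the sent triple.\<close>

definition beta :: "'u \<Rightarrow> 'x \<Rightarrow> 'v \<Rightarrow> 'y \<Rightarrow> real" where
  "beta u x v y = total (\<lambda>u x v. g u x v y) u x v"

text \<open>The probability that the likelihood encoder picks \<open>j\<close> and the likelihood decoder picks
  \<open>(k, w, j)\<close>, for the codebook \<open>c\<close>, the message pair \<open>(k, w)\<close> and the state \<open>s\<close>.\<close>

definition hit :: "(nat \<Rightarrow> 'u \<times> (nat \<Rightarrow> 'x) \<times> (nat \<Rightarrow> 'v)) \<Rightarrow> nat \<Rightarrow> nat \<Rightarrow> nat \<Rightarrow> 's \<Rightarrow> real" where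
  "hit c k w j s = lr (cU (c k)) (cV (c k) j) s / sum_lr c k s *
     expect (PZ (cU (c k)) (cV (c k) j) s) (\<lambda>z. expect (W (cX (c k) w) z s)
       (\<lambda>y. score c k w j y / sum_score c y))"

definition correct :: "(nat \<Rightarrow> nat \<Rightarrow> 'x) \<Rightarrow> ('s \<Rightarrow> nat \<Rightarrow> 'z) \<Rightarrow> ('y \<Rightarrow> nat \<times> nat) \<Rightarrow> real" where
  "correct phi1 phi2 psi = (1 / (real Mc * real M1)) * (\<Sum>k<Mc. \<Sum>w<M1. expect Q (\<lambda>s.
     expect (W (phi1 k w) (phi2 s k) s) (\<lambda>y. of_bool (psi y = (k, w)))))"

lemma beta_ge: "g u x v y \<le> beta u x v y"
  unfolding beta_def total_def using g_nonneg
  by (auto intro!: add_nonneg_nonneg mult_nonneg_nonneg expect_nonneg triple_nonneg simp: add.assoc)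

lemma sum_score_ge:
  assumes "k < Mc" "w < M1" "j < J"
  shows "score c k w j y \<le> sum_score c y"
proof -
  have "score c k w j y \<le> (\<Sum>j<J. score c k w j y)"
    using assms g_nonneg by (intro member_le_sum) auto
  also have "\<dots> \<le> (\<Sum>w<M1. \<Sum>j<J. score c k w j y)"
    using assms g_nonneg by (intro member_le_sum[of w _ "\<lambda>w. \<Sum>j<J. score c k w j y"] sum_nonneg) auto
  also have "\<dots> \<le> sum_score c y"
    unfolding sum_score_def
    using assms g_nonneg
    by (intro member_le_sum[of k _ "\<lambda>k. \<Sum>w<M1. \<Sum>j<J. score c k w j y"] sum_nonneg) auto
  finally show ?thesis .
qed

lemma sum_lr_ge: "j < J \<Longrightarrow> lr (cU (c k)) (cV (c k) j) s \<le> sum_lr c k s"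
  unfolding sum_lr_def
  by (rule member_le_sum[of j _ "\<lambda>j. lr (cU (c k)) (cV (c k) j) s"]) (auto simp: lr_nonneg)

lemma expect_ZW:
  "expect (PZ u v s) (\<lambda>z. expect (W x z s) (f z))
    = (\<Sum>z\<in>Zs. \<Sum>y\<in>Ys. pmf (PZ u v s) z * pmf (W x z s) y * f z y)"
  using Zs Ys by (simp add: expect_eq_sum[of Zs] expect_eq_sum[of Ys] sum_distrib_left mult.assoc)

text \<open>The tangent bound makes the summand linear in the two normalising sums, so only their
  conditional means given the triple of the message are needed.\<close>

lemma expect_hit_ge:
  assumes kwj: "k < Mc" "w < M1" "j < J"
  shows "triple (\<lambda>u x v. lr u v s / (lr u v s + J) * expect (PZ u v s) (\<lambda>z. expect (W x z s)
      (\<lambda>y. g u x v y / beta u x v y))) \<le> expect codebook (\<lambda>c. hit c k w j s)"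
proof -
  \<comment> \<open>The integrand with both normalising sums already replaced by
    \<open>lr u v s + J\<close> and \<open>beta u x v y\<close>.\<close>
  define F where "F z y u x v = pmf (PZ u v s) z * pmf (W x z s) y * (lr u v s * g u x v y)
      / ((lr u v s + J) * beta u x v y)" for z y u x v
  define T where "T f c = f (cU (c k)) (cX (c k) w) (cV (c k) j)"
    for f :: "'u \<Rightarrow> 'x \<Rightarrow> 'v \<Rightarrow> real" and c
  have beta0: "0 \<le> beta u x v y" for u x v y
    using order_trans[OF g_nonneg beta_ge] .
  have F0: "0 \<le> F z y u x v" for z y u x v
    unfolding F_def by (intro divide_nonneg_nonneg mult_nonneg_nonneg add_nonneg_nonneg)
      (auto simp: lr_nonneg g_nonneg beta0)
  have J: "0 < lr u v s + J" for u v using lr_nonneg[of u v s] sizes by linarith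
  have point: "T (F z y) c * (3 - sum_lr c k s / T (\<lambda>u x v. lr u v s + J) c
        - sum_score c y / T (\<lambda>u x v. beta u x v y) c)
      \<le> T (\<lambda>u x v. pmf (PZ u v s) z * pmf (W x z s) y) c *
        (T (\<lambda>u x v. lr u v s) c / sum_lr c k s * (T (\<lambda>u x v. g u x v y) c / sum_score c y))"
    for z y c
  \<comment> \<open>If a numerator vanishes, both sides are 0. Otherwise the sent term alone makes
    both normalising sums positive, and \<open>inverse_mult_ge_tangent\<close> applies to the
    quotients of the sums by their bounds.\<close>
  proof (cases "T (\<lambda>u x v. lr u v s) c = 0 \<or> T (\<lambda>u x v. g u x v y) c = 0")
    case True
    then show ?thesis by (auto simp: T_def F_def)
  next
    case False
    define a where "a = T (\<lambda>u x v. lr u v s) c"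
    define b where "b = T (\<lambda>u x v. g u x v y) c"
    define \<alpha> where "\<alpha> = T (\<lambda>u x v. lr u v s + J) c"
    define \<beta> where "\<beta> = T (\<lambda>u x v. beta u x v y) c"
    define p where "p = T (\<lambda>u x v. pmf (PZ u v s) z * pmf (W x z s) y) c"
    have pos: "a > 0" "b > 0" using False lr_nonneg g_nonneg by (auto simp: T_def a_def b_def less_le)
    have A: "sum_lr c k s > 0" using sum_lr_ge[OF kwj(3), of c k s] pos by (simp add: a_def T_def)
    have B: "sum_score c y > 0" using sum_score_ge[OF kwj, of c y] pos by (simp add: b_def T_def)
    have \<alpha>: "\<alpha> > 0" using J by (simp add: \<alpha>_def T_def)
    have \<beta>: "\<beta> > 0" using beta_ge[of "cU (c k)" "cX (c k) w" "cV (c k) j" y] pos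
      by (simp add: \<beta>_def b_def T_def)
    have p: "p \<ge> 0" by (simp add: p_def T_def)
    have F: "T (F z y) c = p * (a * b) / (\<alpha> * \<beta>)"
      by (simp add: F_def T_def p_def a_def b_def \<alpha>_def \<beta>_def)
    have "p * (a * b) / (\<alpha> * \<beta>) * (3 - sum_lr c k s / \<alpha> - sum_score c y / \<beta>)
       \<le> p * (a * b) / (\<alpha> * \<beta>) * (1 / (sum_lr c k s / \<alpha> * (sum_score c y / \<beta>)))"
      using p pos \<alpha> \<beta> A B by (intro mult_left_mono inverse_mult_ge_tangent) auto
    also have "\<dots> = p * (a / sum_lr c k s * (b / sum_score c y))"
      using \<alpha> \<beta> by (simp add: field_simps)
    finally show ?thesis unfolding F by (simp only: a_def b_def \<alpha>_def \<beta>_def p_def)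
  qed
  have one: "triple (F z y) \<le> expect codebook (\<lambda>c. T (\<lambda>u x v. pmf (PZ u v s) z * pmf (W x z s) y) c *
        (T (\<lambda>u x v. lr u v s) c / sum_lr c k s * (T (\<lambda>u x v. g u x v y) c / sum_score c y)))" for z y
  proof -
    \<comment> \<open>Dividing \<open>F\<close> by one of the bounds prepares a cancellation: the
      mean of the matching sum multiplies that bound back.\<close>
    let ?F1 = "\<lambda>u x v. F z y u x v / (lr u v s + J)"
    let ?F2 = "\<lambda>u x v. F z y u x v / beta u x v y"
    have e0: "expect codebook (T (F z y)) = triple (F z y)"
      unfolding T_def using expect_codebook_component[OF kwj(1),
          of "\<lambda>c. F z y (cU c) (cX c w) (cV c j)"] expect_cluster_triple[OF kwj(2,3)] by simp
    have "expect codebook (\<lambda>c. T ?F1 c * sum_lr c k s) \<le> triple (\<lambda>u x v. ?F1 u x v * (lr u v s + J))"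
      unfolding T_def sum_lr_def
      by (rule expect_total_lr[OF kwj]) (intro divide_nonneg_nonneg F0 less_imp_le[OF J])
    also have "\<dots> = triple (F z y)" using J by (simp add: less_imp_neq[symmetric])
    finally have e1: "expect codebook (\<lambda>c. T ?F1 c * sum_lr c k s) \<le> triple (F z y)" .
    have "expect codebook (\<lambda>c. T ?F2 c * sum_score c y)
        \<le> triple (\<lambda>u x v. ?F2 u x v * total (\<lambda>u x v. g u x v y) u x v)"
      unfolding T_def sum_score_def
      by (rule expect_total_score[OF kwj]) (intro divide_nonneg_nonneg F0 beta0 g_nonneg)+
    also have "\<dots> \<le> triple (F z y)"
      using F0 beta0 by (intro triple_mono) (auto simp: beta_def[symmetric])
    finally have e2: "expect codebook (\<lambda>c. T ?F2 c * sum_score c y) \<le> triple (F z y)" .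
    \<comment> \<open>The count is 3 - 1 - 1 = 1: each of the two subtracted means is at most
      \<open>triple (F z y)\<close>.\<close>
    have "triple (F z y) \<le> 3 * expect codebook (T (F z y))
        - expect codebook (\<lambda>c. T ?F1 c * sum_lr c k s) - expect codebook (\<lambda>c. T ?F2 c * sum_score c y)"
      using e0 e1 e2 by linarith
    also have "\<dots> = expect codebook (\<lambda>c. T (F z y) c * (3 - sum_lr c k s / T (\<lambda>u x v. lr u v s + J) c
        - sum_score c y / T (\<lambda>u x v. beta u x v y) c))"
      by (simp add: T_def[abs_def] algebra_simps expect_diff[OF fin_codebook] expect_add[OF fin_codebook])
    also have "\<dots> \<le> expect codebook (\<lambda>c. T (\<lambda>u x v. pmf (PZ u v s) z * pmf (W x z s) y) c *
        (T (\<lambda>u x v. lr u v s) c / sum_lr c k s * (T (\<lambda>u x v. g u x v y) c / sum_score c y)))"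
      by (intro expect_mono fin_codebook point)
    finally show ?thesis .
  qed
  have "triple (\<lambda>u x v. lr u v s / (lr u v s + J) * expect (PZ u v s) (\<lambda>z. expect (W x z s)
      (\<lambda>y. g u x v y / beta u x v y))) = (\<Sum>z\<in>Zs. \<Sum>y\<in>Ys. triple (F z y))"
    unfolding triple_sum[symmetric] expect_ZW F_def
    by (simp add: sum_distrib_left mult_ac)
  also have "\<dots> \<le> (\<Sum>z\<in>Zs. \<Sum>y\<in>Ys. expect codebook (\<lambda>c. T (\<lambda>u x v. pmf (PZ u v s) z * pmf (W x z s) y) c *
        (T (\<lambda>u x v. lr u v s) c / sum_lr c k s * (T (\<lambda>u x v. g u x v y) c / sum_score c y))))"
    by (intro sum_mono one)
  also have "\<dots> = expect codebook (\<lambda>c. hit c k w j s)"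
    unfolding hit_def expect_ZW
    by (simp add: expect_sum[OF fin_codebook, symmetric] T_def sum_distrib_left mult_ac)
  finally show ?thesis .
qed

section \<open>From random codebooks to deterministic codes\<close>

lemma exists_good_codebook:
  obtains c where "expect Q (\<lambda>s. J * triple (\<lambda>u x v. lr u v s / (lr u v s + J)
      * expect (PZ u v s) (\<lambda>z. expect (W x z s) (\<lambda>y. g u x v y / beta u x v y))))
    \<le> (1 / (real Mc * real M1)) * (\<Sum>k<Mc. \<Sum>w<M1. expect Q (\<lambda>s. \<Sum>j<J. hit c k w j s))"
proof -
  let ?L = "\<lambda>s. triple (\<lambda>u x v. lr u v s / (lr u v s + J)
      * expect (PZ u v s) (\<lambda>z. expect (W x z s) (\<lambda>y. g u x v y / beta u x v y)))"
  let ?C = "\<lambda>c. (1 / (real Mc * real M1)) * (\<Sum>k<Mc. \<Sum>w<M1. expect Q (\<lambda>s. \<Sum>j<J. hit c k w j s))"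
  \<comment> \<open>The bound of \<open>expect_hit_ge\<close> depends on none of \<open>k\<close>,
    \<open>w\<close>, \<open>j\<close>: averaging over the messages leaves it unchanged, and the sum
    over \<open>j\<close> is the factor \<open>J\<close>.\<close>
  have "expect Q (\<lambda>s. J * ?L s) = (1 / (real Mc * real M1)) * (\<Sum>k<Mc. \<Sum>w<M1. expect Q (\<lambda>s. \<Sum>j<J. ?L s))"
    using sizes by simp
  also have "\<dots> \<le> (1 / (real Mc * real M1)) * (\<Sum>k<Mc. \<Sum>w<M1. expect Q (\<lambda>s. \<Sum>j<J. expect codebook (\<lambda>c. hit c k w j s)))"
    by (intro mult_left_mono sum_mono expect_mono fin_Q expect_hit_ge) auto
  also have "\<dots> = expect codebook ?C"
    by (simp only: integral_mult_right_zero expect_sum[OF fin_codebook, symmetric]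
        expect_swap[OF fin_codebook fin_Q, symmetric])
  finally have le: "expect Q (\<lambda>s. J * ?L s) \<le> expect codebook ?C" .
  obtain c where "c \<in> set_pmf codebook" "expect codebook ?C \<le> ?C c"
    by (rule exists_ge_expect[OF fin_codebook])
  then show ?thesis by (intro that[of c] order_trans[OF le])
qed

text \<open>For a fixed codebook the success probability is linear in the encoder's choice for each
  \<open>(k, s)\<close> and then in the decoder's choice for each \<open>y\<close>, so each random
  choice can be replaced by a value that is at least as good.\<close>

lemma derandomise:
  obtains phi1 phi2 psi where
    "(1 / (real Mc * real M1)) * (\<Sum>k<Mc. \<Sum>w<M1. expect Q (\<lambda>s. \<Sum>j<J. hit c k w j s))
      \<le> correct phi1 phi2 psi"
proof -
  \<comment> \<open>The decoder's weight for a message pair alone, its guess of the index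
    \<open>j\<close> being discarded.\<close>
  define D where "D y k w = (\<Sum>j<J. score c k w j y / sum_score c y)" for y k w
  have S0: "0 \<le> sum_score c y" for y
    unfolding sum_score_def by (intro sum_nonneg g_nonneg)
  have D0: "0 \<le> D y k w" for y k w
    unfolding D_def by (intro sum_nonneg divide_nonneg_nonneg g_nonneg S0)
  have D1: "(\<Sum>(k, w)\<in>{..<Mc} \<times> {..<M1}. D y k w) \<le> 1" for y
  proof -
    have "(\<Sum>(k, w)\<in>{..<Mc} \<times> {..<M1}. D y k w) = sum_score c y / sum_score c y"
      unfolding sum.cartesian_product[symmetric] D_def sum_divide_distrib[symmetric]
      by (simp add: sum_score_def)
    then show ?thesis by simp
  qed
  \<comment> \<open>Summed over \<open>w\<close>, since the informed encoder must choose its input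
    from \<open>k\<close> and \<open>s\<close> alone.\<close>
  define H where "H k s z = (\<Sum>w<M1. expect (W (cX (c k) w) z s) (\<lambda>y. D y k w))" for k s z
  have H0: "0 \<le> H k s z" for k s z
    unfolding H_def by (intro sum_nonneg expect_nonneg D0)
  have finZ: "finite (set_pmf (PZ u v s))" and finY: "finite (set_pmf (W x z s))" for u v s x z
    using Zs Ys finite_subset by metis+
  have enc: "\<exists>z. (\<Sum>w<M1. \<Sum>j<J. hit c k w j s) \<le> H k s z" if k: "k < Mc" for k s
  proof -
    let ?p = "\<lambda>j. lr (cU (c k)) (cV (c k) j) s / sum_lr c k s"
    let ?E = "\<lambda>j. expect (PZ (cU (c k)) (cV (c k) j) s) (H k s)"
    have A0: "0 \<le> sum_lr c k s" unfolding sum_lr_def by (intro sum_nonneg lr_nonneg)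
    have p0: "0 \<le> ?p j" for j by (intro divide_nonneg_nonneg lr_nonneg A0)
    have "(\<Sum>j<J. ?p j) = sum_lr c k s / sum_lr c k s"
      unfolding sum_divide_distrib[symmetric] by (simp add: sum_lr_def)
    then have p1: "(\<Sum>j<J. ?p j) \<le> 1" by simp
    \<comment> \<open>From here on a correct message pair counts as success whatever index the
      decoder guesses, which can only raise the probability.\<close>
    have "hit c k w j s \<le> ?p j * expect (PZ (cU (c k)) (cV (c k) j) s)
        (\<lambda>z. expect (W (cX (c k) w) z s) (\<lambda>y. D y k w))" if "j < J" for j w
      unfolding hit_def
    proof (intro mult_left_mono p0 expect_mono finZ finY)
      show "score c k w j y / sum_score c y \<le> D y k w" for y
        unfolding D_def using that S0 g_nonneg
        by (intro member_le_sum[of j _ "\<lambda>j. score c k w j y / sum_score c y"]) auto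
    qed
    then have "(\<Sum>w<M1. \<Sum>j<J. hit c k w j s) \<le> (\<Sum>w<M1. \<Sum>j<J. ?p j * expect (PZ (cU (c k)) (cV (c k) j) s)
        (\<lambda>z. expect (W (cX (c k) w) z s) (\<lambda>y. D y k w)))"
      by (intro sum_mono) auto
    also have "\<dots> = (\<Sum>j<J. ?p j * ?E j)"
      unfolding H_def expect_sum[OF finZ] sum_distrib_left by (rule sum.swap)
    also obtain j where "(\<Sum>j<J. ?p j * ?E j) \<le> ?E j"
      by (rule exists_ge_subconvex_sum[of "{..<J}" ?p ?E])
         (use sizes p0 p1 in \<open>auto intro!: expect_nonneg H0\<close>)
    also obtain z where "z \<in> set_pmf (PZ (cU (c k)) (cV (c k) j) s)" "?E j \<le> H k s z"
      by (rule exists_ge_expect[OF finZ])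
    note this(2)
    finally show ?thesis by blast
  qed
  define phi2 where "phi2 s k = (SOME z. (\<Sum>w<M1. \<Sum>j<J. hit c k w j s) \<le> H k s z)" for s k
  have phi2: "(\<Sum>w<M1. \<Sum>j<J. hit c k w j s) \<le> H k s (phi2 s k)" if "k < Mc" for k s
    unfolding phi2_def using enc[OF that] by (rule someI_ex)
  define phi1 where "phi1 k w = cX (c k) w" for k w
  \<comment> \<open>Once both encoders are fixed, \<open>G y k w\<close> is the chance of output
    \<open>y\<close> under \<open>(k, w)\<close>. The success sum is linear in the weights
    \<open>D\<close>, so \<open>psi\<close> may pick one message pair per output.\<close>
  define G where "G y k w = expect Q (\<lambda>s. pmf (W (phi1 k w) (phi2 s k) s) y)" for y k w
  have dec: "\<exists>m\<in>{..<Mc} \<times> {..<M1}. (\<Sum>(k, w)\<in>{..<Mc} \<times> {..<M1}. D y k w * G y k w) \<le> G y (fst m) (snd m)" for y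
  proof -
    obtain m where "m \<in> {..<Mc} \<times> {..<M1}"
      "(\<Sum>m\<in>{..<Mc} \<times> {..<M1}. D y (fst m) (snd m) * G y (fst m) (snd m)) \<le> G y (fst m) (snd m)"
      by (rule exists_ge_subconvex_sum[of "{..<Mc} \<times> {..<M1}" "\<lambda>m. D y (fst m) (snd m)"
            "\<lambda>m. G y (fst m) (snd m)"])
         (use sizes D0 D1[of y] in \<open>auto simp: G_def case_prod_beta intro!: expect_nonneg\<close>)
    then show ?thesis unfolding case_prod_beta by (rule bexI[rotated])
  qed
  then obtain psi where psi: "\<And>y. psi y \<in> {..<Mc} \<times> {..<M1}"
    "\<And>y. (\<Sum>(k, w)\<in>{..<Mc} \<times> {..<M1}. D y k w * G y k w) \<le> G y (fst (psi y)) (snd (psi y))"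
    by (metis (no_types))
  \<comment> \<open>Used twice: with \<open>D\<close> for the random decoder and with the indicator
    of \<open>psi\<close> for the deterministic one.\<close>
  have sumY: "(\<Sum>k<Mc. \<Sum>w<M1. expect Q (\<lambda>s. expect (W (phi1 k w) (phi2 s k) s) (\<lambda>y. f y k w)))
     = (\<Sum>y\<in>Ys. \<Sum>(k, w)\<in>{..<Mc} \<times> {..<M1}. f y k w * G y k w)" for f
  proof -
    have "expect Q (\<lambda>s. expect (W (phi1 k w) (phi2 s k) s) (\<lambda>y. f y k w)) = (\<Sum>y\<in>Ys. f y k w * G y k w)" for k w
      using Ys by (simp add: expect_eq_sum[of Ys] expect_sum[OF fin_Q] G_def mult.commute)
    then show ?thesis
      by (simp add: sum.cartesian_product[symmetric] sum.swap[of _ Ys "{..<Mc}"] sum.swap[of _ Ys "{..<M1}"])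
  qed
  have "(\<Sum>k<Mc. \<Sum>w<M1. expect Q (\<lambda>s. \<Sum>j<J. hit c k w j s)) = (\<Sum>k<Mc. expect Q (\<lambda>s. \<Sum>w<M1. \<Sum>j<J. hit c k w j s))"
    by (simp add: expect_sum[OF fin_Q])
  also have "\<dots> \<le> (\<Sum>k<Mc. expect Q (\<lambda>s. H k s (phi2 s k)))"
    by (intro sum_mono expect_mono fin_Q phi2) auto
  also have "\<dots> = (\<Sum>y\<in>Ys. \<Sum>(k, w)\<in>{..<Mc} \<times> {..<M1}. D y k w * G y k w)"
    unfolding H_def by (simp add: sumY[symmetric] expect_sum[OF fin_Q] phi1_def)
  also have "\<dots> \<le> (\<Sum>y\<in>Ys. G y (fst (psi y)) (snd (psi y)))"
    by (intro sum_mono psi)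
  also have "\<dots> = (\<Sum>y\<in>Ys. \<Sum>(k, w)\<in>{..<Mc} \<times> {..<M1}. of_bool (psi y = (k, w)) * G y k w)"
  proof (rule sum.cong[OF refl])
    fix y
    have "(\<Sum>(k, w)\<in>{..<Mc} \<times> {..<M1}. of_bool (psi y = (k, w)) * G y k w)
       = (\<Sum>m\<in>{..<Mc} \<times> {..<M1}. if m = psi y then G y (fst m) (snd m) else 0)"
      by (intro sum.cong) (auto simp: case_prod_beta)
    then show "G y (fst (psi y)) (snd (psi y))
       = (\<Sum>(k, w)\<in>{..<Mc} \<times> {..<M1}. of_bool (psi y = (k, w)) * G y k w)"
      using psi(1)[of y] by (simp add: sum.delta)
  qed
  finally have "(\<Sum>k<Mc. \<Sum>w<M1. expect Q (\<lambda>s. \<Sum>j<J. hit c k w j s)) \<le> (\<Sum>k<Mc. \<Sum>w<M1. expect Q (\<lambda>s.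
     expect (W (phi1 k w) (phi2 s k) s) (\<lambda>y. of_bool (psi y = (k, w)))))"
    by (simp add: sumY)
  then have "(1 / (real Mc * real M1)) * (\<Sum>k<Mc. \<Sum>w<M1. expect Q (\<lambda>s. \<Sum>j<J. hit c k w j s))
      \<le> correct phi1 phi2 psi"
    unfolding correct_def by (intro mult_left_mono) auto
  then show ?thesis using that by blast
qed

text \<open>\<open>lr\<close> acts as a change of measure: the blind draw of \<open>v\<close>
  becomes a draw given the state, and the bound becomes a mean under the joint law with
  \<open>PV\<close> in place of \<open>PB\<close>.\<close>

lemma one_shot_bound:
  obtains phi1 phi2 psi where
    "expect Q (\<lambda>s. expect PU (\<lambda>u. expect (PX u) (\<lambda>x. expect (PV u s) (\<lambda>v. expect (PZ u v s) (\<lambda>z.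
       expect (W x z s) (\<lambda>y. J / (pmf (PV u s) v / pmf (PB u) v + J) * (g u x v y / beta u x v y)))))))
     \<le> correct phi1 phi2 psi"
proof -
  have change: "expect (PB u) (\<lambda>v. lr u v s * f v) = expect (PV u s) f" if "s \<in> set_pmf Q" for u s f
    using fin_PB PV_PB[OF that]
    by (simp add: expect_eq_sum[of "set_pmf (PB u)"] lr_def pmf_eq_0_set_pmf)
  have "expect Q (\<lambda>s. expect PU (\<lambda>u. expect (PX u) (\<lambda>x. expect (PV u s) (\<lambda>v. expect (PZ u v s) (\<lambda>z.
       expect (W x z s) (\<lambda>y. J / (pmf (PV u s) v / pmf (PB u) v + J) * (g u x v y / beta u x v y)))))))
    = expect Q (\<lambda>s. expect PU (\<lambda>u. expect (PX u) (\<lambda>x. expect (PB u) (\<lambda>v. lr u v s * expect (PZ u v s) (\<lambda>z.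
       expect (W x z s) (\<lambda>y. J / (lr u v s + J) * (g u x v y / beta u x v y)))))))"
    by (rule expect_cong) (simp add: change lr_def[symmetric])
  also have "\<dots> = expect Q (\<lambda>s. J * triple (\<lambda>u x v. lr u v s / (lr u v s + J)
      * expect (PZ u v s) (\<lambda>z. expect (W x z s) (\<lambda>y. g u x v y / beta u x v y))))"
    unfolding triple_def
    by (simp add: integral_mult_right_zero[symmetric] mult_ac del: integral_mult_right_zero)
  finally have eq: "expect Q (\<lambda>s. expect PU (\<lambda>u. expect (PX u) (\<lambda>x. expect (PV u s) (\<lambda>v. expect (PZ u v s) (\<lambda>z.
       expect (W x z s) (\<lambda>y. J / (pmf (PV u s) v / pmf (PB u) v + J) * (g u x v y / beta u x v y)))))))
    = expect Q (\<lambda>s. J * triple (\<lambda>u x v. lr u v s / (lr u v s + J)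
      * expect (PZ u v s) (\<lambda>z. expect (W x z s) (\<lambda>y. g u x v y / beta u x v y))))" .
  obtain c where c: "expect Q (\<lambda>s. J * triple (\<lambda>u x v. lr u v s / (lr u v s + J)
      * expect (PZ u v s) (\<lambda>z. expect (W x z s) (\<lambda>y. g u x v y / beta u x v y))))
    \<le> (1 / (real Mc * real M1)) * (\<Sum>k<Mc. \<Sum>w<M1. expect Q (\<lambda>s. \<Sum>j<J. hit c k w j s))"
    by (rule exists_good_codebook)
  obtain phi1 phi2 psi where
    "(1 / (real Mc * real M1)) * (\<Sum>k<Mc. \<Sum>w<M1. expect Q (\<lambda>s. \<Sum>j<J. hit c k w j s))
      \<le> correct phi1 phi2 psi"
    by (rule derandomise)
  with c show ?thesis unfolding eq[symmetric] by (intro that) (rule order_trans)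
qed

end

subsection \<open>The law of the auxiliary variables\<close>

locale test_channel =
  fixes Q :: "'s::finite pmf" and W :: "'x1::finite \<Rightarrow> 'x2::finite \<Rightarrow> 's \<Rightarrow> 'y::finite pmf"
    and PU :: "nat pmf" and PX :: "nat \<Rightarrow> 'x1 pmf" and PV :: "nat \<Rightarrow> 's \<Rightarrow> nat pmf"
    and PZ :: "nat \<Rightarrow> nat \<Rightarrow> 's \<Rightarrow> 'x2 pmf"
  assumes fin_PU: "finite (set_pmf PU)" and fin_PV: "\<And>u s. finite (set_pmf (PV u s))"
begin

text \<open>The law of \<open>U\<^sub>2\<close> given \<open>U\<^sub>1\<close>: the state is
  independent of \<open>U\<^sub>1\<close>, so it is averaged with its prior
  \<open>Q\<close>.\<close>

definition PB :: "nat \<Rightarrow> nat pmf" where "PB u = bind_pmf Q (PV u)"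

text \<open>The joint mass of \<open>(v, y)\<close> given \<open>(u, x)\<close>.\<close>

definition ker :: "nat \<Rightarrow> 'x1 \<Rightarrow> nat \<Rightarrow> 'y \<Rightarrow> real" where
  "ker u x v y = expect Q (\<lambda>s. pmf (PV u s) v * expect (PZ u v s) (\<lambda>z. pmf (W x z s) y))"

text \<open>The conditional probability of the output \<open>y\<close> given \<open>(u, x, v)\<close>, and the ones given only
  \<open>(u, v)\<close>, \<open>(u, x)\<close>, \<open>u\<close> and nothing.\<close>

definition g :: "nat \<Rightarrow> 'x1 \<Rightarrow> nat \<Rightarrow> 'y \<Rightarrow> real" where
  "g u x v y = ker u x v y / pmf (PB u) v"
definition gx :: "nat \<Rightarrow> nat \<Rightarrow> 'y \<Rightarrow> real" where
  "gx u v y = expect (PX u) (\<lambda>x. g u x v y)"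
definition gv :: "nat \<Rightarrow> 'x1 \<Rightarrow> 'y \<Rightarrow> real" where
  "gv u x y = expect (PB u) (\<lambda>v. g u x v y)"
definition gxv :: "nat \<Rightarrow> 'y \<Rightarrow> real" where
  "gxv u y = expect (PX u) (\<lambda>x. gv u x y)"
definition gt :: "'y \<Rightarrow> real" where
  "gt y = expect PU (\<lambda>u. gxv u y)"

definition lr1 :: "nat \<Rightarrow> nat \<Rightarrow> 's \<Rightarrow> real" where
  "lr1 u v s = pmf (PV u s) v / pmf (PB u) v"

definition law :: "('s \<times> nat \<times> nat \<times> 'x1 \<times> 'x2 \<times> 'y) pmf" where
  "law = joint Q W PU PX PV PZ"

lemma fin_PB: "finite (set_pmf (PB u))"
  unfolding PB_def using fin_PV by simp

lemma PV_PB: "s \<in> set_pmf Q \<Longrightarrow> set_pmf (PV u s) \<subseteq> set_pmf (PB u)"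
  unfolding PB_def by auto

lemma g_nonneg: "0 \<le> g u x v y"
  unfolding g_def ker_def by (intro divide_nonneg_nonneg expect_nonneg mult_nonneg_nonneg) auto

lemma gv_nonneg: "0 \<le> gv u x y"
  unfolding gv_def by (intro expect_nonneg g_nonneg)

lemma gxv_nonneg: "0 \<le> gxv u y"
  unfolding gxv_def by (intro expect_nonneg gv_nonneg)

section \<open>Expectations and marginals of the single-letter law\<close>

lemma fin_law: "finite (set_pmf law)"
  unfolding law_def joint_def using fin_PU fin_PV by simp

lemma expect_law:
  "expect law F = expect Q (\<lambda>s. expect PU (\<lambda>u. expect (PX u) (\<lambda>x. expect (PV u s) (\<lambda>v.
     expect (PZ u v s) (\<lambda>z. expect (W x z s) (\<lambda>y. F (s, u, v, x, z, y)))))))"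
  unfolding law_def joint_def using fin_PU fin_PV by (simp add: expect_bind)

text \<open>Two ways to draw \<open>(v, y)\<close> given \<open>(u, x)\<close>: through the state
  and the channel, or \<open>v\<close> from its marginal and then \<open>y\<close> from
  \<open>g\<close>.\<close>

lemma expect_PB_g:
  "expect (PB u) (\<lambda>v. c v * (\<Sum>y\<in>UNIV. e y * g u x v y))
    = expect Q (\<lambda>s. expect (PV u s) (\<lambda>v. c v * expect (PZ u v s) (\<lambda>z. expect (W x z s) e)))"
proof -
  let ?S = "set_pmf (PB u)"
  have "expect Q (\<lambda>s. expect (PV u s) (\<lambda>v. c v * expect (PZ u v s) (\<lambda>z. expect (W x z s) e)))
     = expect Q (\<lambda>s. \<Sum>v\<in>?S. pmf (PV u s) v * (c v * expect (PZ u v s) (\<lambda>z. expect (W x z s) e)))"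
    by (intro expect_cong expect_eq_sum fin_PB PV_PB)
  also have "\<dots> = expect Q (\<lambda>s. \<Sum>v\<in>?S. \<Sum>y\<in>UNIV. c v * e y * (pmf (PV u s) v * expect (PZ u v s) (\<lambda>z. pmf (W x z s) y)))"
    by (simp add: expect_eq_sum[of UNIV "W _ _ _"] expect_sum sum_distrib_left mult_ac)
  also have "\<dots> = (\<Sum>v\<in>?S. \<Sum>y\<in>UNIV. c v * e y * ker u x v y)"
    by (simp add: expect_sum ker_def)
  also have "\<dots> = expect (PB u) (\<lambda>v. c v * (\<Sum>y\<in>UNIV. e y * g u x v y))"
    by (simp add: expect_eq_sum[of ?S] fin_PB g_def sum_distrib_left)
       (intro sum.cong refl, simp add: set_pmf_iff)
  finally show ?thesis by simp
qed

text \<open>Product test functions suffice for the marginals, as the indicator of a point factors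
  over the coordinates. The state and \<open>z\<close> are integrated out.\<close>

lemma expect_law_product:
  "expect law (\<lambda>(s, u, v, x, z, y). a u * b x * c v * e y)
    = expect PU (\<lambda>u. a u * expect (PX u) (\<lambda>x. b x * expect (PB u) (\<lambda>v. c v * (\<Sum>y\<in>UNIV. e y * g u x v y))))"
proof -
  have "expect law (\<lambda>(s, u, v, x, z, y). a u * b x * c v * e y)
     = expect Q (\<lambda>s. expect PU (\<lambda>u. expect (PX u) (\<lambda>x. a u * b x *
        expect (PV u s) (\<lambda>v. c v * expect (PZ u v s) (\<lambda>z. expect (W x z s) e)))))"
    by (simp add: expect_law mult.assoc)
  also have "\<dots> = expect PU (\<lambda>u. expect (PX u) (\<lambda>x. expect Q (\<lambda>s. a u * b x *
        expect (PV u s) (\<lambda>v. c v * expect (PZ u v s) (\<lambda>z. expect (W x z s) e)))))"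
    using fin_PU by (simp add: expect_swap[of Q])
  also have "\<dots> = expect PU (\<lambda>u. a u * expect (PX u) (\<lambda>x. b x * expect (PB u) (\<lambda>v. c v * (\<Sum>y\<in>UNIV. e y * g u x v y))))"
    by (simp add: expect_PB_g mult.assoc)
  finally show ?thesis .
qed

lemma sum_g:
  assumes "v \<in> set_pmf (PB u)"
  shows "(\<Sum>y\<in>UNIV. g u x v y) = 1"
proof -
  have "(\<Sum>y\<in>UNIV. ker u x v y) = expect Q (\<lambda>s. pmf (PV u s) v * expect (PZ u v s) (\<lambda>z. \<Sum>y\<in>UNIV. pmf (W x z s) y))"
    unfolding ker_def by (simp add: expect_sum sum_distrib_left)
  also have "\<dots> = pmf (PB u) v" by (simp add: sum_pmf_eq_1 PB_def pmf_bind)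
  finally show ?thesis using assms by (simp add: g_def sum_divide_distrib[symmetric] set_pmf_iff)
qed

text \<open>A coordinate that the marginal forgets gets the constant factor 1; hence the literal
  factors \<open>1\<close> in the hypotheses below.\<close>

lemma marginal:
  assumes "\<And>s u v x z y. of_bool (f (s, u, v, x, z, y) = t) = a u * b x * c v * e y"
  shows "pmf (map_pmf f law) t
    = expect PU (\<lambda>u. a u * expect (PX u) (\<lambda>x. b x * expect (PB u) (\<lambda>v. c v * (\<Sum>y\<in>UNIV. e y * g u x v y))))"
proof -
  have "(\<lambda>w. of_bool (f w = t)) = (\<lambda>(s, u, v, x, z, y). a u * b x * c v * e y)"
    using assms by auto
  then show ?thesis by (simp add: pmf_map_expect expect_law_product)
qed

lemma sum_delta_g: "(\<Sum>y\<in>UNIV. of_bool (y = y0) * g u x v y) = g u x v y0"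
  by (simp add: of_bool_def if_distrib[of "\<lambda>t. t * _"] cong: if_cong)

lemma expect_PB_one: "expect (PB u) (\<lambda>v. c v * (\<Sum>y\<in>UNIV. 1 * g u x v y)) = expect (PB u) c"
  by (intro expect_cong) (simp add: sum_g)

lemma marginal_uxvy:
  assumes "\<And>s u v x z y. of_bool (f (s, u, v, x, z, y) = t)
    = (of_bool (u = u0) * of_bool (x = x0) * of_bool (v = v0) * of_bool (y = y0) :: real)"
  shows "pmf (map_pmf f law) t = pmf PU u0 * (pmf (PX u0) x0 * (pmf (PB u0) v0 * g u0 x0 v0 y0))"
  using assms by (simp add: marginal[where a = "\<lambda>u. of_bool (u = u0)" and b = "\<lambda>x. of_bool (x = x0)"
        and c = "\<lambda>v. of_bool (v = v0)" and e = "\<lambda>y. of_bool (y = y0)"] sum_delta_g expect_delta)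

lemma marginal_uvy:
  assumes "\<And>s u v x z y. of_bool (f (s, u, v, x, z, y) = t)
    = (of_bool (u = u0) * 1 * of_bool (v = v0) * of_bool (y = y0) :: real)"
  shows "pmf (map_pmf f law) t = pmf PU u0 * (pmf (PB u0) v0 * gx u0 v0 y0)"
  using marginal[of f t "\<lambda>u. of_bool (u = u0)" "\<lambda>_. 1" "\<lambda>v. of_bool (v = v0)" "\<lambda>y. of_bool (y = y0)", OF assms] by (simp add: sum_delta_g expect_delta gx_def)

lemma marginal_uxy:
  assumes "\<And>s u v x z y. of_bool (f (s, u, v, x, z, y) = t)
    = (of_bool (u = u0) * of_bool (x = x0) * 1 * of_bool (y = y0) :: real)"
  shows "pmf (map_pmf f law) t = pmf PU u0 * (pmf (PX u0) x0 * gv u0 x0 y0)"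
  using marginal[of f t "\<lambda>u. of_bool (u = u0)" "\<lambda>x. of_bool (x = x0)" "\<lambda>_. 1" "\<lambda>y. of_bool (y = y0)", OF assms] by (simp add: sum_delta_g expect_delta gv_def)

lemma marginal_uy:
  assumes "\<And>s u v x z y. of_bool (f (s, u, v, x, z, y) = t)
    = (of_bool (u = u0) * 1 * 1 * of_bool (y = y0) :: real)"
  shows "pmf (map_pmf f law) t = pmf PU u0 * gxv u0 y0"
  using marginal[of f t "\<lambda>u. of_bool (u = u0)" "\<lambda>_. 1" "\<lambda>_. 1" "\<lambda>y. of_bool (y = y0)", OF assms] by (simp add: sum_delta_g expect_delta gv_def gxv_def)

lemma marginal_y:
  assumes "\<And>s u v x z y. of_bool (f (s, u, v, x, z, y) = t) = (1 * 1 * 1 * of_bool (y = y0) :: real)"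
  shows "pmf (map_pmf f law) t = gt y0"
  using marginal[of f t "\<lambda>_. 1" "\<lambda>_. 1" "\<lambda>_. 1" "\<lambda>y. of_bool (y = y0)", OF assms] by (simp add: sum_delta_g gv_def gxv_def gt_def)

lemma marginal_uxv:
  assumes "\<And>s u v x z y. of_bool (f (s, u, v, x, z, y) = t)
    = (of_bool (u = u0) * of_bool (x = x0) * of_bool (v = v0) * 1 :: real)"
  shows "pmf (map_pmf f law) t = pmf PU u0 * (pmf (PX u0) x0 * pmf (PB u0) v0)"
  using marginal[of f t "\<lambda>u. of_bool (u = u0)" "\<lambda>x. of_bool (x = x0)" "\<lambda>v. of_bool (v = v0)" "\<lambda>_. 1", OF assms]
  unfolding expect_PB_one by (simp add: expect_delta expect_point)

lemma marginal_uv: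
  assumes "\<And>s u v x z y. of_bool (f (s, u, v, x, z, y) = t) = (of_bool (u = u0) * 1 * of_bool (v = v0) * 1 :: real)"
  shows "pmf (map_pmf f law) t = pmf PU u0 * pmf (PB u0) v0"
  using marginal[of f t "\<lambda>u. of_bool (u = u0)" "\<lambda>_. 1" "\<lambda>v. of_bool (v = v0)" "\<lambda>_. 1", OF assms]
  unfolding expect_PB_one by (simp add: expect_delta expect_point)

lemma marginal_ux:
  assumes "\<And>s u v x z y. of_bool (f (s, u, v, x, z, y) = t) = (of_bool (u = u0) * of_bool (x = x0) * 1 * 1 :: real)"
  shows "pmf (map_pmf f law) t = pmf PU u0 * pmf (PX u0) x0"
  using marginal[of f t "\<lambda>u. of_bool (u = u0)" "\<lambda>x. of_bool (x = x0)" "\<lambda>_. 1" "\<lambda>_. 1", OF assms]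
  unfolding expect_PB_one by (simp add: expect_delta expect_point)

lemma marginal_u:
  assumes "\<And>s u v x z y. of_bool (f (s, u, v, x, z, y) = t) = (of_bool (u = u0) * 1 * 1 * 1 :: real)"
  shows "pmf (map_pmf f law) t = pmf PU u0"
  using marginal[of f t "\<lambda>u. of_bool (u = u0)" "\<lambda>_. 1" "\<lambda>_. 1" "\<lambda>_. 1", OF assms]
  unfolding expect_PB_one by (simp add: expect_delta expect_point)

text \<open>Marginals that keep the state come directly from the order of generation, since
  \<open>expect_law_product\<close> has averaged the state away.\<close>

lemma marginal_usv:
  assumes "\<And>s u v x z y. of_bool (f (s, u, v, x, z, y) = t) = (of_bool (s = s0) * (of_bool (u = u0) * of_bool (v = v0)) :: real)"
  shows "pmf (map_pmf f law) t = pmf Q s0 * (pmf PU u0 * pmf (PV u0 s0) v0)"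
  unfolding pmf_map_expect expect_law by (simp add: assms expect_delta expect_point)

lemma marginal_us:
  assumes "\<And>s u v x z y. of_bool (f (s, u, v, x, z, y) = t) = (of_bool (s = s0) * of_bool (u = u0) :: real)"
  shows "pmf (map_pmf f law) t = pmf Q s0 * pmf PU u0"
  unfolding pmf_map_expect expect_law by (simp add: assms expect_delta expect_point)

text \<open>A point of the support has positive mass in every marginal, and a positive product of
  nonnegative factors has positive factors.\<close>

lemma law_positive:
  assumes "(s, u, v, x, z, y) \<in> set_pmf law"
  shows "0 < pmf Q s" "0 < pmf PU u" "0 < pmf (PX u) x" "0 < pmf (PB u) v" "0 < lr1 u v s"
    "0 < g u x v y" "0 < gx u v y" "0 < gv u x y" "0 < gxv u y" "0 < gt y"
proof -
  note pos = pmf_map_pos[OF assms]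
  have "0 < pmf PU u * (pmf (PX u) x * (pmf (PB u) v * g u x v y))"
    using pos[of "\<lambda>(s, u, v, x, z, y). (u, x, v, y)"] by (subst (asm) marginal_uxvy) auto
  then show *: "0 < pmf PU u" "0 < pmf (PX u) x" "0 < pmf (PB u) v" "0 < g u x v y"
    using g_nonneg by (auto simp: zero_less_mult_iff not_less pmf_nonneg less_le)
  have "0 < pmf PU u * (pmf (PB u) v * gx u v y)"
    using pos[of "\<lambda>(s, u, v, x, z, y). (u, v, y)"] by (subst (asm) marginal_uvy) auto
  then show "0 < gx u v y" using * by (simp add: zero_less_mult_iff)
  have "0 < pmf PU u * (pmf (PX u) x * gv u x y)"
    using pos[of "\<lambda>(s, u, v, x, z, y). (u, x, y)"] by (subst (asm) marginal_uxy) auto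
  then show "0 < gv u x y" using * by (simp add: zero_less_mult_iff)
  have "0 < pmf PU u * gxv u y"
    using pos[of "\<lambda>(s, u, v, x, z, y). (u, y)"] by (subst (asm) marginal_uy) auto
  then show "0 < gxv u y" using * by (simp add: zero_less_mult_iff)
  show "0 < gt y"
    using pos[of "\<lambda>(s, u, v, x, z, y). y"] by (subst (asm) marginal_y) auto
  have "0 < pmf Q s * (pmf PU u * pmf (PV u s) v)"
    using pos[of "\<lambda>(s, u, v, x, z, y). (s, u, v)"] by (subst (asm) marginal_usv) auto
  then show "0 < pmf Q s" "0 < lr1 u v s"
    using * by (auto simp: zero_less_mult_iff lr1_def)
qed

section \<open>Information quantities as means of log-densities\<close>

lemma v_simps:
  "vS (s, u, v, x, z, y) = s" "vU1 (s, u, v, x, z, y) = u" "vU2 (s, u, v, x, z, y) = v"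
  "vX1 (s, u, v, x, z, y) = x" "vY (s, u, v, x, z, y) = y"
  by (simp_all add: vS_def vU1_def vU2_def vX1_def vY_def)

lemma surj_vars:
  "surj (vS :: 's \<times> nat \<times> nat \<times> 'x1 \<times> 'x2 \<times> 'y \<Rightarrow> _)"
  "surj (vU1 :: 's \<times> nat \<times> nat \<times> 'x1 \<times> 'x2 \<times> 'y \<Rightarrow> _)"
  "surj (vU2 :: 's \<times> nat \<times> nat \<times> 'x1 \<times> 'x2 \<times> 'y \<Rightarrow> _)"
  "surj (vX1 :: 's \<times> nat \<times> nat \<times> 'x1 \<times> 'x2 \<times> 'y \<Rightarrow> _)"
  "surj (vY :: 's \<times> nat \<times> nat \<times> 'x1 \<times> 'x2 \<times> 'y \<Rightarrow> _)"
  "surj (\<lambda>w :: 's \<times> nat \<times> nat \<times> 'x1 \<times> 'x2 \<times> 'y. (vU1 w, vX1 w))"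
  "surj (\<lambda>w :: 's \<times> nat \<times> nat \<times> 'x1 \<times> 'x2 \<times> 'y. (vU1 w, vU2 w))"
  "surj (\<lambda>w :: 's \<times> nat \<times> nat \<times> 'x1 \<times> 'x2 \<times> 'y. (vX1 w, vU2 w))"
  "surj (\<lambda>w :: 's \<times> nat \<times> nat \<times> 'x1 \<times> 'x2 \<times> 'y. (vX1 w, vU1 w, vU2 w))"
  unfolding surj_def by (auto simp: v_simps)

text \<open>Here and in the four lemmas after it, factors common to the marginals cancel. The
  expectation sees only points of the support, where these factors are positive.\<close>

lemma CMI_V_S: "CMI law vU2 vS vU1 = expect law (\<lambda>(s, u, v, x, z, y). log 2 (lr1 u v s))"
proof -
  have "pmf (map_pmf (\<lambda>w. (vU2 w, vS w, vU1 w)) law) (v, s, u) = pmf Q s * (pmf PU u * pmf (PV u s) v)"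
    "pmf (map_pmf vU1 law) u = pmf PU u"
    "pmf (map_pmf (\<lambda>w. (vU2 w, vU1 w)) law) (v, u) = pmf PU u * pmf (PB u) v"
    "pmf (map_pmf (\<lambda>w. (vS w, vU1 w)) law) (s, u) = pmf Q s * pmf PU u" for u v s
    by (rule marginal_usv marginal_u marginal_uv marginal_us; auto simp: v_simps)+
  then show ?thesis
    unfolding CMI_eq_expect[OF fin_law surj_vars(3,1,2)]
    by (intro expect_cong) (auto simp: v_simps lr1_def dest: law_positive)
qed

lemma CMI_X_Y: "CMI law vX1 vY (\<lambda>w. (vU1 w, vU2 w))
  = expect law (\<lambda>(s, u, v, x, z, y). log 2 (g u x v y / gx u v y))"
proof -
  have "pmf (map_pmf (\<lambda>w. (vX1 w, vY w, vU1 w, vU2 w)) law) (x, y, u, v)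
      = pmf PU u * (pmf (PX u) x * (pmf (PB u) v * g u x v y))"
    "pmf (map_pmf (\<lambda>w. (vU1 w, vU2 w)) law) (u, v) = pmf PU u * pmf (PB u) v"
    "pmf (map_pmf (\<lambda>w. (vX1 w, vU1 w, vU2 w)) law) (x, u, v) = pmf PU u * (pmf (PX u) x * pmf (PB u) v)"
    "pmf (map_pmf (\<lambda>w. (vY w, vU1 w, vU2 w)) law) (y, u, v) = pmf PU u * (pmf (PB u) v * gx u v y)"
    for u v x y
    by (rule marginal_uxvy marginal_uv marginal_uxv marginal_uvy; auto simp: v_simps)+
  then show ?thesis
    unfolding CMI_eq_expect[OF fin_law surj_vars(4,5,7)]
    by (intro expect_cong) (auto simp: v_simps dest: law_positive)
qed

lemma CMI_V_Y: "CMI law vU2 vY (\<lambda>w. (vU1 w, vX1 w))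
  = expect law (\<lambda>(s, u, v, x, z, y). log 2 (g u x v y / gv u x y))"
proof -
  have "pmf (map_pmf (\<lambda>w. (vU2 w, vY w, vU1 w, vX1 w)) law) (v, y, u, x)
      = pmf PU u * (pmf (PX u) x * (pmf (PB u) v * g u x v y))"
    "pmf (map_pmf (\<lambda>w. (vU1 w, vX1 w)) law) (u, x) = pmf PU u * pmf (PX u) x"
    "pmf (map_pmf (\<lambda>w. (vU2 w, vU1 w, vX1 w)) law) (v, u, x) = pmf PU u * (pmf (PX u) x * pmf (PB u) v)"
    "pmf (map_pmf (\<lambda>w. (vY w, vU1 w, vX1 w)) law) (y, u, x) = pmf PU u * (pmf (PX u) x * gv u x y)"
    for u v x y
    by (rule marginal_uxvy marginal_ux marginal_uxv marginal_uxy; auto simp: v_simps)+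
  then show ?thesis
    unfolding CMI_eq_expect[OF fin_law surj_vars(3,5,6)]
    by (intro expect_cong) (auto simp: v_simps dest: law_positive)
qed

lemma CMI_XV_Y: "CMI law (\<lambda>w. (vX1 w, vU2 w)) vY vU1
  = expect law (\<lambda>(s, u, v, x, z, y). log 2 (g u x v y / gxv u y))"
proof -
  have "pmf (map_pmf (\<lambda>w. ((vX1 w, vU2 w), vY w, vU1 w)) law) ((x, v), y, u)
      = pmf PU u * (pmf (PX u) x * (pmf (PB u) v * g u x v y))"
    "pmf (map_pmf vU1 law) u = pmf PU u"
    "pmf (map_pmf (\<lambda>w. ((vX1 w, vU2 w), vU1 w)) law) ((x, v), u) = pmf PU u * (pmf (PX u) x * pmf (PB u) v)"
    "pmf (map_pmf (\<lambda>w. (vY w, vU1 w)) law) (y, u) = pmf PU u * gxv u y"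
    for u v x y
    by (rule marginal_uxvy marginal_u marginal_uxv marginal_uy; auto simp: v_simps)+
  then show ?thesis
    unfolding CMI_eq_expect[OF fin_law surj_vars(8,5,2)]
    by (intro expect_cong) (auto simp: v_simps dest: law_positive)
qed

lemma MI_XUV_Y: "MI law (\<lambda>w. (vX1 w, vU1 w, vU2 w)) vY
  = expect law (\<lambda>(s, u, v, x, z, y). log 2 (g u x v y / gt y))"
proof -
  have "pmf (map_pmf (\<lambda>w. ((vX1 w, vU1 w, vU2 w), vY w)) law) ((x, u, v), y)
      = pmf PU u * (pmf (PX u) x * (pmf (PB u) v * g u x v y))"
    "pmf (map_pmf (\<lambda>w. (vX1 w, vU1 w, vU2 w)) law) (x, u, v) = pmf PU u * (pmf (PX u) x * pmf (PB u) v)"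
    "pmf (map_pmf vY law) y = gt y"
    for u v x y
    by (rule marginal_uxvy marginal_uxv marginal_y; auto simp: v_simps)+
  then show ?thesis
    unfolding MI_eq_expect[OF surj_vars(9,5)]
    by (intro expect_cong) (auto simp: v_simps dest: law_positive)
qed

text \<open>Nonnegativity of a relative entropy, from \<open>1 - 1 / r \<le> ln r\<close> and the
  fact that the mean of \<open>1 / lr1\<close> is at most 1. It makes the bin rate of the final
  proof nonnegative.\<close>

lemma CMI_V_S_nonneg: "0 \<le> CMI law vU2 vS vU1"
proof -
  have *: "expect (PV u s) (\<lambda>v. 1 / lr1 u v s) \<le> 1" for u s
  proof -
    have "expect (PV u s) (\<lambda>v. 1 / lr1 u v s) = (\<Sum>v\<in>set_pmf (PV u s). pmf (PB u) v)"
      by (simp add: expect_eq_sum[OF fin_PV order_refl] lr1_def set_pmf_iff)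
    also have "\<dots> \<le> 1"
      using fin_PV by (simp add: measure_measure_pmf_finite[symmetric])
    finally show ?thesis .
  qed
  have "expect law (\<lambda>(s, u, v, x, z, y). 1 / lr1 u v s)
     = expect Q (\<lambda>s. expect PU (\<lambda>u. expect (PV u s) (\<lambda>v. 1 / lr1 u v s)))"
    by (simp add: expect_law)
  also have "\<dots> \<le> 1"
    by (intro expect_le_const[of Q] expect_le_const[of PU] fin_PU *) simp
  finally have 1: "expect law (\<lambda>(s, u, v, x, z, y). 1 / lr1 u v s) \<le> 1" .
  have lone: "expect law (\<lambda>_. 1) = 1" by simp
  have ln: "1 - 1 / r \<le> ln r" if "r > 0" for r :: real
    using ln_le_minus_one[of "1 / r"] that by (simp add: ln_div)
  have "0 \<le> expect law (\<lambda>w. 1 - (case w of (s, u, v, x, z, y) \<Rightarrow> 1 / lr1 u v s))"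
    using 1 lone unfolding expect_diff[OF fin_law] by linarith
  also have "\<dots> \<le> expect law (\<lambda>(s, u, v, x, z, y). ln (lr1 u v s))"
    by (intro expect_mono fin_law) (auto intro!: ln law_positive)
  also have "\<dots> = ln 2 * CMI law vU2 vS vU1"
    unfolding CMI_V_S integral_mult_right_zero[symmetric]
    by (intro expect_cong) (auto simp: log_def)
  finally show ?thesis by (simp add: zero_le_mult_iff)
qed

end

subsection \<open>Block codes\<close>

text \<open>With the default value \<open>undefined\<close>, supports lie in the extensional
  functions over which \<open>err_prob\<close> sums.\<close>

abbreviation seq_pmf :: "nat \<Rightarrow> (nat \<Rightarrow> 'a pmf) \<Rightarrow> (nat \<Rightarrow> 'a) pmf" where
  "seq_pmf n p \<equiv> Pi_pmf {..<n} undefined p"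

lemma seqs_eq_PiE_dflt: "PiE_dflt {..<n} undefined (\<lambda>_. UNIV) = PiE {..<n} (\<lambda>_. UNIV)"
  for n :: nat
  by (auto simp: PiE_dflt_def PiE_def extensional_def)

lemma finite_seqs: "finite (PiE {..<n} (\<lambda>_. UNIV :: 'a::finite set))" for n :: nat
  by (intro finite_PiE) auto

lemma set_seq_pmf: "set_pmf (seq_pmf n p) \<subseteq> PiE {..<n} (\<lambda>_. UNIV)"
  unfolding seqs_eq_PiE_dflt[symmetric] by (auto simp: set_Pi_pmf PiE_dflt_def)

lemma expect_seq_pmf:
  fixes p :: "nat \<Rightarrow> 'a::finite pmf"
  shows "expect (seq_pmf n p) f = (\<Sum>x\<in>PiE {..<n} (\<lambda>_. UNIV). (\<Prod>i<n. pmf (p i) (x i)) * f x)"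
proof -
  have "pmf (seq_pmf n p) x = (\<Prod>i<n. pmf (p i) (x i))" if "x \<in> PiE {..<n} (\<lambda>_. UNIV)" for x
    by (rule pmf_Pi') (use PiE_arb[OF that] in auto)
  then show ?thesis
    by (subst expect_eq_sum[OF finite_seqs set_seq_pmf]) (intro sum.cong refl, simp)
qed

text \<open>The bridge from the one-shot success probability \<open>correct\<close>, taken at
  product laws, to the error sum in the definition of achievability.\<close>

lemma correct_eq_err_prob:
  fixes Q :: "'s::finite pmf" and W :: "'x1 \<Rightarrow> 'x2 \<Rightarrow> 's \<Rightarrow> 'y::finite pmf"
  assumes "0 < Mc" "0 < M1"
  shows "(1 / (real Mc * real M1)) * (\<Sum>k<Mc. \<Sum>w<M1. expect (seq_pmf n (\<lambda>_. Q)) (\<lambda>s.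
     expect (seq_pmf n (\<lambda>i. W (phi1 k w i) (phi2 s k i) (s i))) (\<lambda>y. of_bool (psi y = (k, w)))))
     = 1 - err_prob Q W n Mc M1 phi1 phi2 psi"
proof -
  have err: "(\<Sum>s\<in>PiE {..<n} (\<lambda>_. UNIV). \<Sum>y\<in>PiE {..<n} (\<lambda>_. UNIV). (\<Prod>i<n. pmf Q (s i)) *
          (\<Prod>i<n. pmf (W (phi1 k w i) (phi2 s k i) (s i)) (y i)) * (if psi y \<noteq> (k, w) then 1 else 0))
     = 1 - expect (seq_pmf n (\<lambda>_. Q)) (\<lambda>s. expect (seq_pmf n (\<lambda>i. W (phi1 k w i) (phi2 s k i) (s i)))
         (\<lambda>y. of_bool (psi y = (k, w))))" (is "?l = 1 - ?r") for k w
  proof -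
    have "?l = expect (seq_pmf n (\<lambda>_. Q)) (\<lambda>s. expect (seq_pmf n (\<lambda>i. W (phi1 k w i) (phi2 s k i) (s i)))
         (\<lambda>y. 1 - of_bool (psi y = (k, w))))"
      unfolding expect_seq_pmf sum_distrib_left by (intro sum.cong refl) auto
    also have "\<dots> = 1 - ?r"
      by (simp add: expect_diff finite_set_Pi_pmf)
    finally show ?thesis .
  qed
  show ?thesis
    unfolding err_prob_def err using assms by (simp add: sum_subtractf field_simps)
qed

lemma expect_prod_seq:
  assumes "\<And>i. finite (set_pmf (p i))" "\<And>i x. 0 \<le> f i x"
  shows "expect (seq_pmf n p) (\<lambda>x. \<Prod>i<n. f i (x i)) = (\<Prod>i<n. expect (p i) (f i))"
  by (rule expectation_prod_Pi_pmf) (auto intro: integrable_measure_pmf_finite assms)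

section \<open>Product laws in the one-shot bound\<close>

context test_channel
begin

definition wlr :: "'s \<times> nat \<times> nat \<times> 'x1 \<times> 'x2 \<times> 'y \<Rightarrow> real" where
  "wlr w = lr1 (vU1 w) (vU2 w) (vS w)"
definition wg :: "'s \<times> nat \<times> nat \<times> 'x1 \<times> 'x2 \<times> 'y \<Rightarrow> real" where
  "wg w = g (vU1 w) (vX1 w) (vU2 w) (vY w)"
definition wgx :: "'s \<times> nat \<times> nat \<times> 'x1 \<times> 'x2 \<times> 'y \<Rightarrow> real" where
  "wgx w = gx (vU1 w) (vU2 w) (vY w)"
definition wgv :: "'s \<times> nat \<times> nat \<times> 'x1 \<times> 'x2 \<times> 'y \<Rightarrow> real" where
  "wgv w = gv (vU1 w) (vX1 w) (vY w)"
definition wgxv :: "'s \<times> nat \<times> nat \<times> 'x1 \<times> 'x2 \<times> 'y \<Rightarrow> real" where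
  "wgxv w = gxv (vU1 w) (vY w)"
definition wgt :: "'s \<times> nat \<times> nat \<times> 'x1 \<times> 'x2 \<times> 'y \<Rightarrow> real" where
  "wgt w = gt (vY w)"

lemmas w_defs = wlr_def wg_def wgx_def wgv_def wgxv_def wgt_def

text \<open>Drawing independent coordinates agrees with drawing whole sequences variable by
  variable, which is the order of the one-shot bound.\<close>

lemma expect_iid_law:
  "expect (seq_pmf n (\<lambda>_. law)) F = expect (seq_pmf n (\<lambda>_. Q)) (\<lambda>s. expect (seq_pmf n (\<lambda>_. PU)) (\<lambda>u.
     expect (seq_pmf n (\<lambda>i. PX (u i))) (\<lambda>x. expect (seq_pmf n (\<lambda>i. PV (u i) (s i))) (\<lambda>v.
     expect (seq_pmf n (\<lambda>i. PZ (u i) (v i) (s i))) (\<lambda>z. expect (seq_pmf n (\<lambda>i. W (x i) (z i) (s i))) (\<lambda>y.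
       F (\<lambda>i. if i \<in> {..<n} then (s i, u i, v i, x i, z i, y i) else undefined)))))))"
proof -
  have "seq_pmf n (\<lambda>_. law) = bind_pmf (seq_pmf n (\<lambda>_. Q)) (\<lambda>s. bind_pmf (seq_pmf n (\<lambda>_. PU)) (\<lambda>u.
     bind_pmf (seq_pmf n (\<lambda>i. PX (u i))) (\<lambda>x. bind_pmf (seq_pmf n (\<lambda>i. PV (u i) (s i))) (\<lambda>v.
     bind_pmf (seq_pmf n (\<lambda>i. PZ (u i) (v i) (s i))) (\<lambda>z. bind_pmf (seq_pmf n (\<lambda>i. W (x i) (z i) (s i))) (\<lambda>y.
       return_pmf (\<lambda>i. if i \<in> {..<n} then (s i, u i, v i, x i, z i, y i) else undefined)))))))"
    unfolding law_def joint_def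
    by (simp only: Pi_pmf_bind[OF finite_lessThan, where d' = undefined] Pi_pmf_return_pmf[OF finite_lessThan])
  then show ?thesis
    by (simp add: expect_bind finite_set_Pi_pmf fin_PU fin_PV)
qed

text \<open>The one-shot bound at product laws. The likelihood ratio, the metric and all its partial
  means factor over the coordinates, so the decoder's denominator is a sum of five products.\<close>

lemma n_letter_bound:
  fixes Mc M1 L :: nat
  assumes "0 < Mc" "0 < M1" "0 < L"
  obtains phi1 phi2 psi where
    "expect (seq_pmf n (\<lambda>_. law)) (\<lambda>\<omega>. L / ((\<Prod>i<n. wlr (\<omega> i)) + L) * ((\<Prod>i<n. wg (\<omega> i)) /
      ((\<Prod>i<n. wg (\<omega> i)) + M1 * (\<Prod>i<n. wgx (\<omega> i)) + L * (\<Prod>i<n. wgv (\<omega> i))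
        + M1 * L * (\<Prod>i<n. wgxv (\<omega> i)) + Mc * M1 * L * (\<Prod>i<n. wgt (\<omega> i)))))
     \<le> 1 - err_prob Q W n Mc M1 phi1 phi2 psi"
proof -
  let ?PX = "\<lambda>u. seq_pmf n (\<lambda>i. PX (u i))" and ?PV = "\<lambda>u s. seq_pmf n (\<lambda>i. PV (u i) (s i))"
    and ?PB = "\<lambda>u. seq_pmf n (\<lambda>i. PB (u i))" and ?PZ = "\<lambda>u v s. seq_pmf n (\<lambda>i. PZ (u i) (v i) (s i))"
    and ?W = "\<lambda>x z s. seq_pmf n (\<lambda>i. W (x i) (z i) (s i))"
    and ?Q = "seq_pmf n (\<lambda>_. Q)" and ?PU = "seq_pmf n (\<lambda>_. PU)"
    and ?g = "\<lambda>u x v y. \<Prod>i<n. g (u i) (x i) (v i) (y i)"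
  interpret B: one_shot ?Q ?PU ?PX ?PV ?PB ?PZ ?W ?g Mc M1 L
    "PiE {..<n} (\<lambda>_. UNIV)" "PiE {..<n} (\<lambda>_. UNIV)"
  proof
    show "set_pmf (?PV u s) \<subseteq> set_pmf (?PB u)" if "s \<in> set_pmf ?Q" for u s
      using that PV_PB by (auto simp: set_Pi_pmf PiE_dflt_def) blast
  qed (use assms in \<open>auto intro!: finite_set_Pi_pmf fin_PU fin_PB finite_seqs set_seq_pmf prod_nonneg g_nonneg\<close>)
  have beta: "B.beta u x v y = ?g u x v y + M1 * (\<Prod>i<n. gx (u i) (v i) (y i)) + L * (\<Prod>i<n. gv (u i) (x i) (y i))
     + M1 * L * (\<Prod>i<n. gxv (u i) (y i)) + Mc * M1 * L * (\<Prod>i<n. gt (y i))" for u x v y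
  proof -
    have 1: "expect (?PX u) (\<lambda>x. ?g u x v y) = (\<Prod>i<n. gx (u i) (v i) (y i))" for u v y
      unfolding gx_def by (rule expect_prod_seq) (auto intro: g_nonneg)
    have 2: "expect (?PB u) (\<lambda>v. ?g u x v y) = (\<Prod>i<n. gv (u i) (x i) (y i))" for u x y
      unfolding gv_def by (rule expect_prod_seq) (auto intro: g_nonneg fin_PB)
    have 3: "expect (?PX u) (\<lambda>x. \<Prod>i<n. gv (u i) (x i) (y i)) = (\<Prod>i<n. gxv (u i) (y i))" for u y
      unfolding gxv_def by (rule expect_prod_seq) (auto intro: gv_nonneg)
    have 4: "expect ?PU (\<lambda>u. \<Prod>i<n. gxv (u i) (y i)) = (\<Prod>i<n. gt (y i))" for y
      unfolding gt_def by (rule expect_prod_seq) (auto intro: gxv_nonneg fin_PU)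
    show ?thesis
      unfolding B.beta_def B.total_def B.triple_def 1 2 3 4 ..
  qed
  \<comment> \<open>On the support, \<open>v\<close> is \<open>undefined\<close> beyond the block,
    as the product formula for the sequence masses requires.\<close>
  have lr: "pmf (?PV u s) v / pmf (?PB u) v = (\<Prod>i<n. lr1 (u i) (v i) (s i))"
    if "v \<in> set_pmf (?PV u s)" for u v s
  proof -
    have v: "v i = undefined" if "i \<notin> {..<n}" for i
      using that \<open>v \<in> _\<close> by (auto simp: set_Pi_pmf PiE_dflt_def)
    have "pmf (seq_pmf n p) v = (\<Prod>i<n. pmf (p i) (v i))" for p
      by (rule pmf_Pi') (auto intro: v)
    then show ?thesis by (simp add: lr1_def prod_dividef)
  qed
  have eq: "expect (seq_pmf n (\<lambda>_. law)) (\<lambda>\<omega>. L / ((\<Prod>i<n. wlr (\<omega> i)) + L) * ((\<Prod>i<n. wg (\<omega> i)) /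
      ((\<Prod>i<n. wg (\<omega> i)) + M1 * (\<Prod>i<n. wgx (\<omega> i)) + L * (\<Prod>i<n. wgv (\<omega> i))
        + M1 * L * (\<Prod>i<n. wgxv (\<omega> i)) + Mc * M1 * L * (\<Prod>i<n. wgt (\<omega> i)))))
    = expect ?Q (\<lambda>s. expect ?PU (\<lambda>u. expect (?PX u) (\<lambda>x. expect (?PV u s) (\<lambda>v. expect (?PZ u v s) (\<lambda>z.
       expect (?W x z s) (\<lambda>y. L / (pmf (?PV u s) v / pmf (?PB u) v + L) * (?g u x v y / B.beta u x v y)))))))"
    unfolding expect_iid_law
    by (intro expect_cong) (simp add: lr beta w_defs v_simps)
  obtain phi1 phi2 psi where "expect ?Q (\<lambda>s. expect ?PU (\<lambda>u. expect (?PX u) (\<lambda>x. expect (?PV u s) (\<lambda>v. expect (?PZ u v s) (\<lambda>z.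
       expect (?W x z s) (\<lambda>y. L / (pmf (?PV u s) v / pmf (?PB u) v + L) * (?g u x v y / B.beta u x v y)))))))
     \<le> B.correct phi1 phi2 psi"
    by (rule B.one_shot_bound)
  then show ?thesis
    using that[of phi1 phi2 psi] correct_eq_err_prob[OF assms(1,2), of n Q W phi1 phi2 psi]
    unfolding eq B.correct_def by simp
qed

end

section \<open>Rounded message counts and exponents\<close>

lemma num_msgs_ge: "2 powr (real n * R) \<le> real (num_msgs n R)"
  unfolding num_msgs_def by linarith

lemma num_msgs_pos: "0 < num_msgs n R"
  using less_le_trans[OF _ num_msgs_ge[of n R], of 0] by simp

text \<open>For a nonnegative rate the power is at least 1, so the factor 2 absorbs the rounding
  up.\<close>

lemma num_msgs_le:
  assumes "0 \<le> R"
  shows "real (num_msgs n R) \<le> 2 * 2 powr (real n * R)"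
proof -
  have "1 \<le> 2 powr (real n * R)" using assms by (intro ge_one_powr_ge_zero) auto
  moreover have "real (num_msgs n R) \<le> 2 powr (real n * R) + 1"
    unfolding num_msgs_def using calculation by linarith
  ultimately show ?thesis by linarith
qed

lemma err_prob_nonneg: "0 \<le> err_prob Q W n Mc M1 phi1 phi2 psi"
  unfolding err_prob_def by (intro mult_nonneg_nonneg sum_nonneg prod_nonneg) auto

lemma prod_eq_powr_sum_log:
  fixes f :: "'i \<Rightarrow> real"
  assumes "\<And>i. i \<in> A \<Longrightarrow> 0 < f i"
  shows "(\<Prod>i\<in>A. f i) = 2 powr (\<Sum>i\<in>A. log 2 (f i))"
proof -
  have "2 powr (\<Sum>i\<in>A. log 2 (f i)) = (\<Prod>i\<in>A. 2 powr log 2 (f i))"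
    by (rule powr_sum) simp
  also have "\<dots> = (\<Prod>i\<in>A. f i)" using assms by (intro prod.cong) auto
  finally show ?thesis by simp
qed

text \<open>The competing terms add up to at most \<open>16 * t * G\<close>, as 2 + 2 + 4 + 8 = 16;
  these powers of 2 will come from rounding one, two or three counts.\<close>

lemma fraction_product_ge:
  fixes t L r G a b c d :: real
  assumes "0 \<le> t" "0 < L" "0 \<le> r" "r \<le> t * L" "0 < G" "0 \<le> a" "0 \<le> b" "0 \<le> c" "0 \<le> d"
    "a \<le> 2 * t * G" "b \<le> 2 * t * G" "c \<le> 4 * t * G" "d \<le> 8 * t * G"
  shows "1 / ((1 + t) * (1 + 16 * t)) \<le> L / (r + L) * (G / (G + a + b + c + d))"
proof -
  have "1 / (1 + t) \<le> L / (r + L)" "1 / (1 + 16 * t) \<le> G / (G + a + b + c + d)"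
    using assms by (auto simp: field_simps)
  then have "1 / (1 + t) * (1 / (1 + 16 * t)) \<le> L / (r + L) * (G / (G + a + b + c + d))"
    using assms by (intro mult_mono) auto
  then show ?thesis by simp
qed

section \<open>Vanishing error below the single-letter bounds\<close>

context test_channel
begin

lemma w_pos:
  assumes "w \<in> set_pmf law"
  shows "0 < wlr w" "0 < wg w" "0 < wgx w" "0 < wgv w" "0 < wgxv w" "0 < wgt w"
  using assms by (cases w; auto simp: w_defs v_simps dest: law_positive)+

text \<open>\<open>R'\<close> is the rate of the number of codewords that the informed encoder has
  per common message. Of the slack \<open>2 * \<delta>\<close>, one half pays for the deviation in
  the law of large numbers and the other becomes the vanishing factor \<open>T n\<close>.\<close>

lemma achievable_rates:
  assumes \<delta>: "0 < \<delta>" and R: "0 \<le> Rc" "0 \<le> R1" "0 \<le> R'"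
    and lr: "expect law (\<lambda>w. log 2 (wlr w)) + 2 * \<delta> \<le> R'"
    and x: "R1 + 2 * \<delta> \<le> expect law (\<lambda>w. log 2 (wg w / wgx w))"
    and v: "R' + 2 * \<delta> \<le> expect law (\<lambda>w. log 2 (wg w / wgv w))"
    and xv: "R1 + R' + 2 * \<delta> \<le> expect law (\<lambda>w. log 2 (wg w / wgxv w))"
    and t: "Rc + R1 + R' + 2 * \<delta> \<le> expect law (\<lambda>w. log 2 (wg w / wgt w))"
  shows "achievable Q W Rc R1"
proof -
  define dev where "dev f n = {\<omega>. real n * \<delta> \<le> \<bar>(\<Sum>i<n. f (\<omega> i)) - real n * expect law f\<bar>}"
    for f :: "'s \<times> nat \<times> nat \<times> 'x1 \<times> 'x2 \<times> 'y \<Rightarrow> real" and n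
  define F where "F = [\<lambda>w. log 2 (wlr w), \<lambda>w. log 2 (wg w / wgx w), \<lambda>w. log 2 (wg w / wgv w),
     \<lambda>w. log 2 (wg w / wgxv w), \<lambda>w. log 2 (wg w / wgt w)]"
  \<comment> \<open>The union bound over the five deviation events.\<close>
  define e where "e n = (\<Sum>f\<leftarrow>F. measure_pmf.prob (seq_pmf n (\<lambda>_. law)) (dev f n))" for n
  define T where "T n = 2 powr (- (real n * \<delta>))" for n
  \<comment> \<open>The bound of \<open>fraction_product_ge\<close> at \<open>t = T n\<close>; it
    tends to 1.\<close>
  define c where "c n = 1 / ((1 + T n) * (1 + 16 * T n))" for n
  have T: "0 < T n" for n by (simp add: T_def)
  have dev_lim: "(\<lambda>n. measure_pmf.prob (seq_pmf n (\<lambda>_. law)) (dev f n)) \<longlonglongrightarrow> 0" for f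
    unfolding dev_def by (rule weak_law_Pi_pmf[OF fin_law \<delta>])
  have e_lim: "e \<longlonglongrightarrow> 0"
    unfolding e_def F_def list.map sum_list.Cons sum_list.Nil
    by (rule tendsto_eq_intros dev_lim refl)+ simp
  have T_lim: "T \<longlonglongrightarrow> 0"
  proof -
    have "T = (\<lambda>n. (2 powr (- \<delta>)) ^ n)"
      unfolding T_def by (simp add: powr_realpow[symmetric] powr_powr mult.commute)
    then show ?thesis using \<delta> by (simp add: LIMSEQ_power_zero powr_less_one)
  qed
  have code: "\<exists>phi1 phi2 psi. err_prob Q W n (num_msgs n Rc) (num_msgs n R1) phi1 phi2 psi
      \<le> 1 - (1 - e n) * c n" for n
  proof -
    define Mc M1 L where "Mc = num_msgs n Rc" and "M1 = num_msgs n R1" and "L = num_msgs n R'"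
    let ?P = "seq_pmf n (\<lambda>_. law)"
    define H where "H \<omega> = L / ((\<Prod>i<n. wlr (\<omega> i)) + L) * ((\<Prod>i<n. wg (\<omega> i)) /
      ((\<Prod>i<n. wg (\<omega> i)) + M1 * (\<Prod>i<n. wgx (\<omega> i)) + L * (\<Prod>i<n. wgv (\<omega> i))
        + M1 * L * (\<Prod>i<n. wgxv (\<omega> i)) + Mc * M1 * L * (\<Prod>i<n. wgt (\<omega> i))))" for \<omega>
    have sizes: "0 < Mc" "0 < M1" "0 < L" by (simp_all add: Mc_def M1_def L_def num_msgs_pos)
    have Mc: "real Mc \<le> 2 * 2 powr (n * Rc)" and M1: "real M1 \<le> 2 * 2 powr (n * R1)"
      and L: "real L \<le> 2 * 2 powr (n * R')" "2 powr (n * R') \<le> real L"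
      using R by (simp_all add: Mc_def M1_def L_def num_msgs_le num_msgs_ge)
    have M1L: "real (M1 * L) \<le> 4 * 2 powr (n * (R1 + R'))"
      using mult_mono[OF M1 L(1)] by (simp add: powr_add distrib_left)
    have McM1L: "real (Mc * M1 * L) \<le> 8 * 2 powr (n * (Rc + R1 + R'))"
      using mult_mono[OF Mc M1L] by (simp add: powr_add distrib_left mult_ac)
    have supp: "\<omega> i \<in> set_pmf law" if "\<omega> \<in> set_pmf ?P" "i < n" for \<omega> i
      using that by (auto simp: set_Pi_pmf PiE_dflt_def)
    have pos: "0 < (\<Prod>i<n. wlr (\<omega> i))" "0 < (\<Prod>i<n. wg (\<omega> i))" "0 < (\<Prod>i<n. wgx (\<omega> i))"
      "0 < (\<Prod>i<n. wgv (\<omega> i))" "0 < (\<Prod>i<n. wgxv (\<omega> i))" "0 < (\<Prod>i<n. wgt (\<omega> i))"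
      if "\<omega> \<in> set_pmf ?P" for \<omega>
      using supp[OF that] by (auto intro!: prod_pos w_pos)
    have H0: "0 \<le> H \<omega>" if "\<omega> \<in> set_pmf ?P" for \<omega>
      unfolding H_def using pos[OF that]
      by (intro mult_nonneg_nonneg divide_nonneg_nonneg add_nonneg_nonneg) auto
    define good where "good = {\<omega>. \<forall>f\<in>set F. \<omega> \<notin> dev f n}"
    \<comment> \<open>One argument for all four competing sums: \<open>M\<close> counts the
      competitors of a kind, \<open>h\<close> is the mean metric of one of them per letter, and
      \<open>C\<close> collects the rounding.\<close>
    have atypical: "real M * (\<Prod>i<n. h (\<omega> i)) \<le> C * T n * (\<Prod>i<n. wg (\<omega> i))"
      if \<omega>: "\<omega> \<in> set_pmf ?P" "\<omega> \<in> good" and h: "\<And>w. w \<in> set_pmf law \<Longrightarrow> 0 < h w"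
        and f: "(\<lambda>w. log 2 (wg w / h w)) \<in> set F"
        and rate: "r + 2 * \<delta> \<le> expect law (\<lambda>w. log 2 (wg w / h w))"
        and M: "real M \<le> C * 2 powr (n * r)" and C: "0 \<le> C" for \<omega> h M C and r :: real
    proof -
      let ?f = "\<lambda>w. log 2 (wg w / h w)"
      have hp: "0 < (\<Prod>i<n. h (\<omega> i))" by (rule prod_pos) (auto intro!: h supp \<omega>)
      have "\<omega> \<notin> dev ?f n" using \<omega> f by (auto simp: good_def)
      then have "real n * expect law ?f - real n * \<delta> \<le> (\<Sum>i<n. ?f (\<omega> i))"
        by (auto simp: dev_def abs_le_iff)
      moreover have "real n * (r + 2 * \<delta>) \<le> real n * expect law ?f"
        using rate by (intro mult_left_mono) auto
      ultimately have "real n * (r + \<delta>) \<le> (\<Sum>i<n. ?f (\<omega> i))"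
        by (simp add: algebra_simps)
      then have "2 powr (real n * (r + \<delta>)) \<le> 2 powr (\<Sum>i<n. ?f (\<omega> i))" by simp
      also have "\<dots> = (\<Prod>i<n. wg (\<omega> i) / h (\<omega> i))"
        by (rule prod_eq_powr_sum_log[symmetric]) (auto intro!: divide_pos_pos h w_pos supp \<omega>)
      also have "\<dots> = (\<Prod>i<n. wg (\<omega> i)) / (\<Prod>i<n. h (\<omega> i))" by (rule prod_dividef)
      finally have *: "2 powr (real n * (r + \<delta>)) * (\<Prod>i<n. h (\<omega> i)) \<le> (\<Prod>i<n. wg (\<omega> i))"
        using hp by (simp add: pos_le_divide_eq)
      have "real M * (\<Prod>i<n. h (\<omega> i)) \<le> C * 2 powr (n * r) * (\<Prod>i<n. h (\<omega> i))"
        using M hp by (intro mult_right_mono) auto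
      also have "2 powr (n * r) = T n * 2 powr (real n * (r + \<delta>))"
        by (simp add: T_def powr_add[symmetric] algebra_simps)
      also have "C * (T n * 2 powr (real n * (r + \<delta>))) * (\<Prod>i<n. h (\<omega> i))
          = C * T n * (2 powr (real n * (r + \<delta>)) * (\<Prod>i<n. h (\<omega> i)))" by (simp add: mult_ac)
      also have "\<dots> \<le> C * T n * (\<Prod>i<n. wg (\<omega> i))"
        using * C T[of n] by (intro mult_left_mono) auto
      finally show ?thesis .
    qed
    \<comment> \<open>The likelihood ratio is negligible against \<open>L\<close>, so the encoder's
      factor in \<open>H\<close> is close to 1.\<close>
    have cover: "(\<Prod>i<n. wlr (\<omega> i)) \<le> T n * L" if \<omega>: "\<omega> \<in> set_pmf ?P" "\<omega> \<in> good" for \<omega>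
    proof -
      let ?f = "\<lambda>w. log 2 (wlr w)"
      have "\<omega> \<notin> dev ?f n" using \<omega> by (auto simp: good_def F_def)
      then have "(\<Sum>i<n. ?f (\<omega> i)) \<le> real n * expect law ?f + real n * \<delta>"
        by (auto simp: dev_def abs_le_iff)
      moreover have "real n * (expect law ?f + 2 * \<delta>) \<le> real n * R'"
        using lr by (intro mult_left_mono) auto
      ultimately have "(\<Sum>i<n. ?f (\<omega> i)) \<le> - (real n * \<delta>) + real n * R'"
        by (simp add: algebra_simps)
      then have "2 powr (\<Sum>i<n. ?f (\<omega> i)) \<le> 2 powr (- (real n * \<delta>) + real n * R')" by simp
      also have "\<dots> = T n * 2 powr (real n * R')" unfolding T_def by (rule powr_add)
      also have "\<dots> \<le> T n * L" using L T[of n] by (intro mult_left_mono) auto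
      also have "2 powr (\<Sum>i<n. ?f (\<omega> i)) = (\<Prod>i<n. wlr (\<omega> i))"
        by (rule prod_eq_powr_sum_log[symmetric]) (auto intro!: w_pos supp \<omega>)
      finally show ?thesis .
    qed
    have H1: "c n \<le> H \<omega>" if \<omega>: "\<omega> \<in> set_pmf ?P" "\<omega> \<in> good" for \<omega>
      unfolding c_def H_def
    proof (rule fraction_product_ge)
      show "M1 * (\<Prod>i<n. wgx (\<omega> i)) \<le> 2 * T n * (\<Prod>i<n. wg (\<omega> i))"
        by (rule atypical[OF \<omega> _ _ x M1]) (auto simp: F_def w_pos)
      show "L * (\<Prod>i<n. wgv (\<omega> i)) \<le> 2 * T n * (\<Prod>i<n. wg (\<omega> i))"
        by (rule atypical[OF \<omega> _ _ v L(1)]) (auto simp: F_def w_pos)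
      show "real (M1 * L) * (\<Prod>i<n. wgxv (\<omega> i)) \<le> 4 * T n * (\<Prod>i<n. wg (\<omega> i))"
        by (rule atypical[OF \<omega> _ _ xv M1L]) (auto simp: F_def w_pos)
      show "real (Mc * M1 * L) * (\<Prod>i<n. wgt (\<omega> i)) \<le> 8 * T n * (\<Prod>i<n. wg (\<omega> i))"
        by (rule atypical[OF \<omega> _ _ t McM1L]) (auto simp: F_def w_pos)
    qed (use pos[OF \<omega>(1)] cover[OF \<omega>] T[of n] sizes in auto)
    have fin: "finite (set_pmf ?P)" by (intro finite_set_Pi_pmf fin_law) simp
    have "measure_pmf.prob ?P (- good) \<le> e n"
    proof -
      have "- good = (\<Union>f\<in>set F. dev f n)" by (auto simp: good_def)
      also have "measure_pmf.prob ?P \<dots> \<le> e n"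
        unfolding e_def by (induction F) (auto intro!: order_trans[OF measure_Un_le])
      finally show ?thesis .
    qed
    then have good: "1 - e n \<le> measure_pmf.prob ?P good"
      using measure_pmf.prob_compl[of good ?P] by (simp add: Compl_eq_Diff_UNIV)
    \<comment> \<open>On \<open>good\<close> the integrand is at least \<open>c n\<close>; elsewhere
      its nonnegativity is enough.\<close>
    have "(1 - e n) * c n \<le> measure_pmf.prob ?P good * c n"
      using good T[of n] by (intro mult_right_mono) (auto simp: c_def)
    also have "\<dots> = expect ?P (\<lambda>\<omega>. indicator good \<omega> * c n)" by simp
    also have "\<dots> \<le> expect ?P H"
      by (intro expect_mono fin) (auto simp: indicator_def H0 H1)
    finally have "(1 - e n) * c n \<le> expect ?P H" .
    moreover obtain phi1 phi2 psi where "expect ?P H \<le> 1 - err_prob Q W n Mc M1 phi1 phi2 psi"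
      unfolding H_def by (rule n_letter_bound[OF sizes])
    ultimately show ?thesis
      unfolding Mc_def M1_def by (intro exI[of _ phi1] exI[of _ phi2] exI[of _ psi]) simp
  qed
  then obtain phi1 phi2 psi where bound: "\<And>n. err_prob Q W n (num_msgs n Rc) (num_msgs n R1) (phi1 n) (phi2 n) (psi n)
      \<le> 1 - (1 - e n) * c n"
    by metis
  have c_lim: "(\<lambda>n. 1 - (1 - e n) * c n) \<longlonglongrightarrow> 0"
    unfolding c_def by (rule tendsto_eq_intros e_lim T_lim refl | simp)+
  have "(\<lambda>n. err_prob Q W n (num_msgs n Rc) (num_msgs n R1) (phi1 n) (phi2 n) (psi n)) \<longlonglongrightarrow> 0"
    by (rule tendsto_sandwich[OF _ _ tendsto_const c_lim])
       (auto simp: bound err_prob_nonneg)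
  then show ?thesis
    unfolding achievable_def using R by blast
qed

end

section \<open>Choice of the bin rate\<close>

theorem theorem1:
  fixes Q :: "'s::finite pmf"
    and W :: "'x1::finite \<Rightarrow> 'x2::finite \<Rightarrow> 's \<Rightarrow> 'y::finite pmf"
  shows "closure (rate_set Q W) \<subseteq> capacity_region Q W"
proof -
  have "achievable Q W Rc R1" if "(Rc, R1) \<in> rate_set Q W" for Rc R1
  proof -
    from that obtain J where J: "J \<in> admissible Q W" and R: "0 \<le> Rc" "0 \<le> R1"
      and R1: "R1 < CMI J vX1 vY (\<lambda>w. (vU1 w, vU2 w))"
      and R1': "R1 < CMI J (\<lambda>w. (vX1 w, vU2 w)) vY vU1 - CMI J vU2 vS vU1"
      and RcR1: "Rc + R1 < MI J (\<lambda>w. (vX1 w, vU1 w, vU2 w)) vY - CMI J vU2 vS vU1"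
      unfolding rate_set_def by blast
    from J obtain PU PX PV PZ where
      PU: "set_pmf PU \<subseteq> {..<card_bound_U1 TYPE('s) TYPE('x1) TYPE('x2)}" and
      PV: "\<forall>u s. set_pmf (PV u s) \<subseteq> {..<card_bound_U2 TYPE('s) TYPE('x1) TYPE('x2)}" and
      J: "J = joint Q W PU PX PV PZ" and
      pos: "CMI J vU2 vY (\<lambda>w. (vU1 w, vX1 w)) - CMI J vU2 vS vU1 > 0"
      unfolding admissible_def by blast
    interpret test_channel Q W PU PX PV PZ
    proof
      show "finite (set_pmf PU)" by (rule finite_subset[OF PU]) simp
      show "finite (set_pmf (PV u s))" for u s by (rule finite_subset[OF PV[rule_format]]) simp
    qed
    define I where "I = CMI law vU2 vS vU1"
    define Ix where "Ix = CMI law vX1 vY (\<lambda>w. (vU1 w, vU2 w))"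
    define Iv where "Iv = CMI law vU2 vY (\<lambda>w. (vU1 w, vX1 w))"
    define Ixv where "Ixv = CMI law (\<lambda>w. (vX1 w, vU2 w)) vY vU1"
    define It where "It = MI law (\<lambda>w. (vX1 w, vU1 w, vU2 w)) vY"
    have gaps: "I < Iv" "R1 < Ix" "R1 < Ixv - I" "Rc + R1 < It - I"
      using R1 R1' RcR1 pos unfolding I_def Iv_def Ix_def Ixv_def It_def law_def J[symmetric] by simp_all
    \<comment> \<open>A quarter of the smallest gap: the bin rate is put \<open>2 * \<delta>\<close>
      above \<open>I\<close>, and another \<open>2 * \<delta>\<close> must remain below each of the
      decoder's bounds.\<close>
    define \<delta> where "\<delta> = min (min (Iv - I) (Ix - R1)) (min (Ixv - I - R1) (It - I - Rc - R1)) / 4"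
    have "0 < \<delta>" and \<delta>: "4 * \<delta> \<le> Iv - I" "4 * \<delta> \<le> Ix - R1" "4 * \<delta> \<le> Ixv - I - R1"
      "4 * \<delta> \<le> It - I - Rc - R1"
      using gaps by (auto simp: \<delta>_def)
    have "0 \<le> I" unfolding I_def by (rule CMI_V_S_nonneg)
    have eqs: "expect law (\<lambda>w. log 2 (wlr w)) = I" "expect law (\<lambda>w. log 2 (wg w / wgx w)) = Ix"
      "expect law (\<lambda>w. log 2 (wg w / wgv w)) = Iv" "expect law (\<lambda>w. log 2 (wg w / wgxv w)) = Ixv"
      "expect law (\<lambda>w. log 2 (wg w / wgt w)) = It"
      unfolding I_def Ix_def Iv_def Ixv_def It_def CMI_V_S CMI_X_Y CMI_V_Y CMI_XV_Y MI_XUV_Y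
      by (intro expect_cong; auto simp: w_defs v_simps)+
    show ?thesis
      by (rule achievable_rates[OF \<open>0 < \<delta>\<close> R, of "I + 2 * \<delta>"];
          use eqs \<open>0 \<le> I\<close> \<open>0 < \<delta>\<close> \<delta> in linarith)
  qed
  then show ?thesis
    unfolding capacity_region_def by (intro closure_mono) auto
qed

end
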